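(* Consider a left-invariant Lorentzian problem on $G=\mathrm{Aff}_+(\mathbb R)$ given by a matrix $A=\begin{pmatrix}a&b\\c&d\end{pmatrix}$, $|A|>0$, $a\ge0$, with sectional curvature $K>0$. The Lorentzian spheres $S(R)=\{q\in G:d(\mathrm{Id},q)=R\}$, $R\in[0,+\infty]$, are as follows. (1) $S(0)=\{q\in G:\lambda_1(q)\ge0\text{ or }\lambda_2(q)\le0\}$. (2) If $R\in(0,+\infty)$, then $$S(R)=\{(x,y)\in G:\ (y-\cosh\sigma)^2-w^2=\sinh^2\sigma\},$$ $$w=\frac{x+\nu(y-1)}{\lambda},\qquad \sigma=s_1\Delta R,\qquad s_1=\operatorname{sgn}\gamma;$$ it is an arc of a hyperbola noncompact in both directions. (3) $S(+\infty)=\emptyset$.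
   Context: $G=\mathrm{Aff}_+(\mathbb R)=\{(x,y)\in\mathbb R^2: y>0\}$ with product $(x_2,y_2)\cdot(x_1,y_1)=(x_2+y_2x_1,\,y_2y_1)$ and identity $\mathrm{Id}=(0,1)$; left-invariant frame $X_1=y\,\partial_x$, $X_2=y\,\partial_y$. A real matrix $A=\begin{pmatrix}a&b\\c&d\end{pmatrix}$ with $|A|=ad-bc>0$ determines the left-invariant Lorentzian form $g(u_1X_1+u_2X_2)=-v_1^2+v_2^2$, $v_1=au_1+bu_2$, $v_2=cu_1+du_2$, with time orientation in which future directed nonspacelike vectors are those with $v_1\ge|v_2|$. Standing assumption of the paper: $a\ge0$. Write $A^{-1}=\begin{pmatrix}\alpha&\beta\\ \gamma&\delta\end{pmatrix}$. The sectional curvature is $K=(c^2-a^2)/|A|^2=\gamma^2-\delta^2$. A future directed nonspacelike curve is a Lipschitz curve whose velocity is a.e. future directed nonspacelike; its Lorentzian length is $\int\sqrt{v_1^2-v_2^2}\,dt$. The Lorentzian distance $d(q_0,q_1)$ is the supremum of lengths of such curves from $q_0$ to $q_1$, and $0$ if there are none. $\lambda_1(x,y)=(c-a)x+(d-b)(y-1)$, $\lambda_2(x,y)=(c+a)x+(d+b)(y-1)$ (here $d$ is the matrix entry). For $K>0$: $\Delta=\sqrt{\gamma^2-\delta^2}$, $\lambda=\frac{\alpha\delta-\beta\gamma}{\Delta^2}$, $\nu=\frac{\beta\delta-\alpha\gamma}{\Delta^2}$. "Noncompact" refers to the topology of $G$.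
   Formalization: In (2) the printed equation is even in σ, so in G it contains points of both branches of the hyperbola, contradicting (1) and "an arc"; the formal statement adds the condition sgn(y − cosh σ) = s_1, which selects the one branch that is S(R). *)

theory Defs
  imports "HOL-Analysis.Analysis"
begin

section \<open>The group and its left-invariant frame\<close>

definition Aff :: "(real \<times> real) set" where
  "Aff = {(x, y). y > 0}"

definition aff_mult :: "real \<times> real \<Rightarrow> real \<times> real \<Rightarrow> real \<times> real" where
  "aff_mult p q = (fst p + snd p * fst q, snd p * snd q)"

definition aff_id :: "real \<times> real" where
  "aff_id = (0, 1)"

definition X1 :: "real \<times> real \<Rightarrow> real \<times> real" where
  "X1 q = (snd q, 0)"

definition X2 :: "real \<times> real \<Rightarrow> real \<times> real" where
  "X2 q = (0, snd q)"

definition frame_coords :: "real \<times> real \<Rightarrow> real \<times> real \<Rightarrow> real^2" where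
  "frame_coords q V = vector [fst V / snd q, snd V / snd q]"

lemma frame_coords_unique:
  assumes "q \<in> Aff"
  shows "V = u $ 1 *\<^sub>R X1 q + u $ 2 *\<^sub>R X2 q \<longleftrightarrow> u = frame_coords q V"
  using assms
  by (auto simp: Aff_def frame_coords_def X1_def X2_def vec_eq_iff forall_2 prod_eq_iff
      field_simps)

lemma frame_left_invariant:
  "(aff_mult p has_derivative (\<lambda>V. snd p *\<^sub>R V)) (at q)"
  "snd p *\<^sub>R X1 q = X1 (aff_mult p q)"
  "snd p *\<^sub>R X2 q = X2 (aff_mult p q)"
proof -
  have "aff_mult p = (\<lambda>q. (fst p, 0) + snd p *\<^sub>R q)"
    by (auto simp: aff_mult_def fun_eq_iff prod_eq_iff)
  then show "(aff_mult p has_derivative (\<lambda>V. snd p *\<^sub>R V)) (at q)"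
    by (auto intro!: derivative_eq_intros)
qed (auto simp: X1_def X2_def aff_mult_def)


section \<open>Left-invariant Lorentzian structures\<close>

text \<open>
  Vectors of type \<^typ>\<open>real^2\<close> are coordinates \<open>(u\<^sub>1, u\<^sub>2)\<close> in the frame \<open>X\<^sub>1, X\<^sub>2\<close>, so they
  also stand for the elements of the Lie algebra. The matrix with rows \<open>(a, b)\<close> and \<open>(c, d)\<close>
  sends them to \<open>(v\<^sub>1, v\<^sub>2)\<close>.
\<close>

definition lorentz_form :: "real^2^2 \<Rightarrow> real^2 \<Rightarrow> real^2 \<Rightarrow> real" where
  "lorentz_form A u w = - (A *v u) $ 1 * (A *v w) $ 1 + (A *v u) $ 2 * (A *v w) $ 2"

definition future_nonspacelike :: "real^2^2 \<Rightarrow> real^2 \<Rightarrow> bool" where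
  "future_nonspacelike A u \<longleftrightarrow> (A *v u) $ 1 \<ge> \<bar>(A *v u) $ 2\<bar>"

text \<open>
  Being Lipschitz does not depend on the choice of a Riemannian metric on \<^const>\<open>Aff\<close>, since the
  curve has a compact image in it; the Euclidean distance is used.
\<close>

definition future_curve ::
    "real^2^2 \<Rightarrow> real \<Rightarrow> real \<Rightarrow> (real \<Rightarrow> real \<times> real) \<Rightarrow> bool" where
  "future_curve A s t c \<longleftrightarrow>
     s \<le> t \<and> c ` {s..t} \<subseteq> Aff \<and> (\<exists>L. L-lipschitz_on {s..t} c) \<and>
     (AE r in lebesgue. r \<in> {s..t} \<longrightarrow>
        c differentiable (at r) \<and>
        future_nonspacelike A (frame_coords (c r) (vector_derivative c (at r))))"

definition lorentz_length ::
    "real^2^2 \<Rightarrow> real \<Rightarrow> real \<Rightarrow> (real \<Rightarrow> real \<times> real) \<Rightarrow> ennreal" where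
  "lorentz_length A s t c =
     (\<integral>\<^sup>+ r \<in> {s..t}. ennreal (let v = A *v frame_coords (c r) (vector_derivative c (at r))
                               in sqrt ((v $ 1)\<^sup>2 - (v $ 2)\<^sup>2)) \<partial>lebesgue)"

text \<open>In \<^typ>\<open>ennreal\<close> the supremum of the empty set is \<open>0\<close>.\<close>

definition lorentz_dist :: "real^2^2 \<Rightarrow> real \<times> real \<Rightarrow> real \<times> real \<Rightarrow> ennreal" where
  "lorentz_dist A p q =
     Sup {lorentz_length A s t c | s t c. future_curve A s t c \<and> c s = p \<and> c t = q}"

definition lorentz_sphere :: "real^2^2 \<Rightarrow> ennreal \<Rightarrow> (real \<times> real) set" where
  "lorentz_sphere A R = {q \<in> Aff. lorentz_dist A aff_id q = R}"


section \<open>Sectional curvature\<close>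

text \<open>The Lie bracket of left-invariant vector fields; here \<open>[X\<^sub>1, X\<^sub>2] = - X\<^sub>1\<close>.\<close>

definition bracket :: "real^2 \<Rightarrow> real^2 \<Rightarrow> real^2" where
  "bracket u w = vector [- (u $ 1 * w $ 2 - u $ 2 * w $ 1), 0]"

lemma bracket_vector_fields:
  fixes u w :: "real^2"
  defines "U \<equiv> \<lambda>q. u $ 1 *\<^sub>R X1 q + u $ 2 *\<^sub>R X2 q"
  defines "W \<equiv> \<lambda>q. w $ 1 *\<^sub>R X1 q + w $ 2 *\<^sub>R X2 q"
  shows "frechet_derivative W (at q) (U q) - frechet_derivative U (at q) (W q) =
         bracket u w $ 1 *\<^sub>R X1 q + bracket u w $ 2 *\<^sub>R X2 q"
proof -
  have "((\<lambda>q. z $ 1 *\<^sub>R X1 q + z $ 2 *\<^sub>R X2 q) has_derivative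
         (\<lambda>q. z $ 1 *\<^sub>R X1 q + z $ 2 *\<^sub>R X2 q)) (at q)" for z :: "real^2"
    unfolding X1_def X2_def by (auto intro!: derivative_eq_intros)
  from frechet_derivative_at[OF this[of u], symmetric]
    frechet_derivative_at[OF this[of w], symmetric]
  have "frechet_derivative U (at q) = U" "frechet_derivative W (at q) = W"
    unfolding U_def W_def .
  then show ?thesis
    by (simp add: U_def W_def X1_def X2_def bracket_def algebra_simps)
qed

text \<open>
  The Levi-Civita connection on left-invariant vector fields, given by the Koszul formula, in
  which the derivatives of the (constant) inner products vanish.
\<close>

definition levi_civita :: "real^2^2 \<Rightarrow> real^2 \<Rightarrow> real^2 \<Rightarrow> real^2" where
  "levi_civita A u w =
     (THE p. \<forall>z. 2 * lorentz_form A p z =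
        lorentz_form A (bracket u w) z - lorentz_form A (bracket w z) u
        + lorentz_form A (bracket z u) w)"

definition riemann_curvature :: "real^2^2 \<Rightarrow> real^2 \<Rightarrow> real^2 \<Rightarrow> real^2 \<Rightarrow> real^2" where
  "riemann_curvature A u w z =
     levi_civita A u (levi_civita A w z) - levi_civita A w (levi_civita A u z)
     - levi_civita A (bracket u w) z"

definition sectional_curvature :: "real^2^2 \<Rightarrow> real" where
  "sectional_curvature A =
     (let e = axis 1 1; f = axis 2 1 in
      lorentz_form A (riemann_curvature A e f f) e /
      (lorentz_form A e e * lorentz_form A f f - (lorentz_form A e f)\<^sup>2))"

lemma matrix_inv_mult:
  fixes A :: "real^'n^'n"
  assumes "det A \<noteq> 0"
  shows "A ** matrix_inv A = mat 1" and "matrix_inv A ** A = mat 1"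
proof -
  have "\<exists>B. A ** B = mat 1 \<and> B ** A = mat 1"
    using assms by (simp add: invertible_det_nz[symmetric] invertible_def)
  then have "A ** matrix_inv A = mat 1 \<and> matrix_inv A ** A = mat 1"
    unfolding matrix_inv_def by (rule someI_ex)
  then show "A ** matrix_inv A = mat 1" and "matrix_inv A ** A = mat 1"
    by simp_all
qed

lemma matrix_inv_2:
  fixes A :: "real^2^2"
  assumes "det A \<noteq> 0"
  shows "matrix_inv A $ 1 $ 1 = A $ 2 $ 2 / det A"
    "matrix_inv A $ 1 $ 2 = - A $ 1 $ 2 / det A"
    "matrix_inv A $ 2 $ 1 = - A $ 2 $ 1 / det A"
    "matrix_inv A $ 2 $ 2 = A $ 1 $ 1 / det A"
proof -
  define B :: "real^2^2" where
    "B = vector [vector [A $ 2 $ 2 / det A, - A $ 1 $ 2 / det A],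
                 vector [- A $ 2 $ 1 / det A, A $ 1 $ 1 / det A]]"
  have "A ** B = mat 1"
    using assms
    by (simp add: B_def vec_eq_iff forall_2 matrix_matrix_mult_def sum_2 mat_def det_2
        divide_simps)
  then have "matrix_inv A ** (A ** B) = matrix_inv A"
    by simp
  then have "matrix_inv A = B"
    by (simp add: matrix_mul_assoc matrix_inv_mult(2)[OF assms])
  then show "matrix_inv A $ 1 $ 1 = A $ 2 $ 2 / det A"
    "matrix_inv A $ 1 $ 2 = - A $ 1 $ 2 / det A"
    "matrix_inv A $ 2 $ 1 = - A $ 2 $ 1 / det A"
    "matrix_inv A $ 2 $ 2 = A $ 1 $ 1 / det A"
    by (simp_all add: B_def)
qed

lemma lorentz_form_nondegenerate:
  fixes A :: "real^2^2"
  assumes "det A \<noteq> 0" and "\<And>z. lorentz_form A p z = lorentz_form A q z"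
  shows "p = q"
proof -
  have inv: "A *v (matrix_inv A *v z) = z" for z
    by (simp add: matrix_vector_mul_assoc matrix_inv_mult(1)[OF assms(1)])
  have "(A *v p) $ 1 = (A *v q) $ 1"
    using assms(2)[of "matrix_inv A *v axis 1 1"]
    by (simp add: lorentz_form_def inv axis_def)
  moreover have "(A *v p) $ 2 = (A *v q) $ 2"
    using assms(2)[of "matrix_inv A *v axis 2 1"]
    by (simp add: lorentz_form_def inv axis_def)
  ultimately have "A *v p = A *v q"
    by (simp add: vec_eq_iff forall_2)
  then have "matrix_inv A *v (A *v p) = matrix_inv A *v (A *v q)"
    by simp
  then show ?thesis
    by (simp add: matrix_vector_mul_assoc matrix_inv_mult(2)[OF assms(1)])
qed

lemma levi_civita_eq:
  fixes A :: "real^2^2"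
  assumes "det A \<noteq> 0"
  shows "levi_civita A u w =
    ((A $ 2 $ 1 * (A *v u) $ 2 - A $ 1 $ 1 * (A *v u) $ 1) / det A) *\<^sub>R
      (matrix_inv A *v vector [(A *v w) $ 2, (A *v w) $ 1])" (is "_ = ?r")
proof -
  have inv: "A *v (matrix_inv A *v z) = z" for z
    by (simp add: matrix_vector_mul_assoc matrix_inv_mult(1)[OF assms(1)])
  define k where "k u w = u $ 1 * w $ 2 - u $ 2 * w $ 1" for u w :: "real^2"
  define l where "l z = A $ 2 $ 1 * (A *v z) $ 2 - A $ 1 $ 1 * (A *v z) $ 1" for z
  have comp: "(A *v z) $ 1 = A $ 1 $ 1 * z $ 1 + A $ 1 $ 2 * z $ 2"
    "(A *v z) $ 2 = A $ 2 $ 1 * z $ 1 + A $ 2 $ 2 * z $ 2" for z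
    by (simp_all add: matrix_vector_mult_def sum_2)
  have form: "2 * lorentz_form A ?r z =
        lorentz_form A (bracket u w) z - lorentz_form A (bracket w z) u
        + lorentz_form A (bracket z u) w" for z
  proof -
    have br: "lorentz_form A (bracket u w) z = - k u w * l z" for u w z
      by (simp add: lorentz_form_def bracket_def comp(1)[of "vector _"] comp(2)[of "vector _"]
          k_def l_def algebra_simps)
    have "(A *v w) $ 1 * (A *v z) $ 2 - (A *v w) $ 2 * (A *v z) $ 1 = det A * k w z"
      by (simp add: comp det_2 k_def algebra_simps)
    moreover have "lorentz_form A ?r z =
        (l u / det A) * ((A *v w) $ 1 * (A *v z) $ 2 - (A *v w) $ 2 * (A *v z) $ 1)"
      by (simp add: lorentz_form_def inv matrix_vector_mult_scaleR l_def[symmetric]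
          right_diff_distrib)
    ultimately have lhs: "lorentz_form A ?r z = l u * k w z"
      using assms by simp
    have "k u w * l z + k w z * l u + k z u * l w = 0"
      unfolding k_def l_def comp by (simp add: algebra_simps)
    then show ?thesis
      unfolding br lhs by (simp add: algebra_simps)
  qed
  show ?thesis
    unfolding levi_civita_def
  proof (rule the_equality)
    fix p
    assume p: "\<forall>z. 2 * lorentz_form A p z =
        lorentz_form A (bracket u w) z - lorentz_form A (bracket w z) u
        + lorentz_form A (bracket z u) w"
    then have "lorentz_form A p z = lorentz_form A ?r z" for z
      using form[of z] p[rule_format, of z] by linarith
    then show "p = ?r"
      by (rule lorentz_form_nondegenerate[OF assms(1)])
  qed (use form in blast)
qed

lemma sectional_curvature_eq:
  fixes A :: "real^2^2"
  assumes "det A \<noteq> 0"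
  shows "sectional_curvature A = ((A $ 2 $ 1)\<^sup>2 - (A $ 1 $ 1)\<^sup>2) / (det A)\<^sup>2"
    and "sectional_curvature A = (matrix_inv A $ 2 $ 1)\<^sup>2 - (matrix_inv A $ 2 $ 2)\<^sup>2"
proof -
  define J where "J w = matrix_inv A *v vector [(A *v w) $ 2, (A *v w) $ 1]" for w
  define m where
    "m u = (A $ 2 $ 1 * (A *v u) $ 2 - A $ 1 $ 1 * (A *v u) $ 1) / det A" for u
  define e f :: "real^2" where "e = axis 1 1" and "f = axis 2 1"
  have lc: "levi_civita A u w = m u *\<^sub>R J w" for u w
    by (simp add: levi_civita_eq[OF assms] J_def m_def)
  have inv: "A *v (matrix_inv A *v z) = z" for z
    by (simp add: matrix_vector_mul_assoc matrix_inv_mult(1)[OF assms(1)])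
  have AJ: "A *v J w = vector [(A *v w) $ 2, (A *v w) $ 1]" for w
    by (simp add: J_def inv)
  have Jscale: "J (r *\<^sub>R w) = r *\<^sub>R J w" for r w
  proof -
    have "vector [r * x, r * y] = r *\<^sub>R (vector [x, y] :: real^2)" for x y
      by (simp add: vec_eq_iff forall_2)
    then show ?thesis
      by (simp add: J_def matrix_vector_mult_scaleR)
  qed
  have R: "riemann_curvature A e f f = (- m (bracket e f)) *\<^sub>R J f"
    by (simp add: riemann_curvature_def lc Jscale mult.commute[of "m e" "m f"])
  have comp: "(A *v z) $ 1 = A $ 1 $ 1 * z $ 1 + A $ 1 $ 2 * z $ 2"
    "(A *v z) $ 2 = A $ 2 $ 1 * z $ 1 + A $ 2 $ 2 * z $ 2" for z
    by (simp_all add: matrix_vector_mult_def sum_2)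
  have ef: "e $ 1 = 1" "e $ 2 = 0" "f $ 1 = 0" "f $ 2 = 1"
    by (simp_all add: e_def f_def axis_def)
  have "- m (bracket e f) = ((A $ 2 $ 1)\<^sup>2 - (A $ 1 $ 1)\<^sup>2) / det A"
    by (simp add: m_def comp bracket_def ef power2_eq_square minus_divide_left)
  moreover have "lorentz_form A (t *\<^sub>R J f) e = - t * det A" for t
    by (simp add: lorentz_form_def matrix_vector_mult_scaleR AJ comp ef det_2 algebra_simps)
  ultimately have num:
    "lorentz_form A (riemann_curvature A e f f) e = - ((A $ 2 $ 1)\<^sup>2 - (A $ 1 $ 1)\<^sup>2)"
    using assms unfolding R by simp
  have den: "lorentz_form A e e * lorentz_form A f f - (lorentz_form A e f)\<^sup>2 = - (det A)\<^sup>2"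
    by (simp add: lorentz_form_def comp ef det_2 power2_eq_square algebra_simps)
  show K: "sectional_curvature A = ((A $ 2 $ 1)\<^sup>2 - (A $ 1 $ 1)\<^sup>2) / (det A)\<^sup>2"
    unfolding sectional_curvature_def Let_def e_def[symmetric] f_def[symmetric] num den
    by (simp add: minus_divide_left)
  show "sectional_curvature A = (matrix_inv A $ 2 $ 1)\<^sup>2 - (matrix_inv A $ 2 $ 2)\<^sup>2"
    unfolding K by (simp add: matrix_inv_2[OF assms] power_divide diff_divide_distrib)
qed


section \<open>Data of the spheres\<close>

definition lambda1 :: "real^2^2 \<Rightarrow> real \<times> real \<Rightarrow> real" where
  "lambda1 A q = (A $ 2 $ 1 - A $ 1 $ 1) * fst q + (A $ 2 $ 2 - A $ 1 $ 2) * (snd q - 1)"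

definition lambda2 :: "real^2^2 \<Rightarrow> real \<times> real \<Rightarrow> real" where
  "lambda2 A q = (A $ 2 $ 1 + A $ 1 $ 1) * fst q + (A $ 2 $ 2 + A $ 1 $ 2) * (snd q - 1)"

definition Delta :: "real^2^2 \<Rightarrow> real" where
  "Delta A = sqrt ((matrix_inv A $ 2 $ 1)\<^sup>2 - (matrix_inv A $ 2 $ 2)\<^sup>2)"

definition lam :: "real^2^2 \<Rightarrow> real" where
  "lam A = (matrix_inv A $ 1 $ 1 * matrix_inv A $ 2 $ 2
            - matrix_inv A $ 1 $ 2 * matrix_inv A $ 2 $ 1) / (Delta A)\<^sup>2"

definition nu :: "real^2^2 \<Rightarrow> real" where
  "nu A = (matrix_inv A $ 1 $ 2 * matrix_inv A $ 2 $ 2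
           - matrix_inv A $ 1 $ 1 * matrix_inv A $ 2 $ 1) / (Delta A)\<^sup>2"

text \<open>A nondegenerate conic whose quadratic part is indefinite.\<close>

definition is_hyperbola :: "(real \<times> real) set \<Rightarrow> bool" where
  "is_hyperbola H \<longleftrightarrow> (\<exists>p q r e f g.
     H = {(x, y). p * x\<^sup>2 + 2 * q * x * y + r * y\<^sup>2 + 2 * e * x + 2 * f * y + g = 0} \<and>
     q\<^sup>2 - p * r > 0 \<and>
     det (vector [vector [p, q, e], vector [q, r, f], vector [e, f, g]] :: real^3^3) \<noteq> 0)"

text \<open>
  An arc in \<open>G\<close>, homeomorphic to the real line, each of whose two ends leaves every compact subset
  of \<open>G\<close>.
\<close>

definition arc_noncompact_both_ways :: "'a::topological_space set \<Rightarrow> 'a set \<Rightarrow> bool" where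
  "arc_noncompact_both_ways G S \<longleftrightarrow> S \<subseteq> G \<and>
     (\<exists>\<phi> \<psi>. homeomorphism (UNIV :: real set) S \<phi> \<psi> \<and>
       (\<forall>C. compact C \<and> C \<subseteq> G \<longrightarrow>
         (\<forall>\<^sub>F t in at_top. \<phi> t \<notin> C) \<and> (\<forall>\<^sub>F t in at_bot. \<phi> t \<notin> C)))"

end

theory Submission
  imports Defs
begin

text \<open>
  The surface is two-dimensional, so everything becomes explicit in null coordinates. Suitable
  constant multiples \<open>U, V\<close> of \<open>\<lambda>\<^sub>1, \<lambda>\<^sub>2\<close> satisfy \<open>y = 1 + U + V\<close> and \<open>w = U - V\<close>; with
  \<open>\<epsilon> = sgn \<gamma>\<close> a velocity is future directed nonspacelike iff \<open>\<epsilon> U' \<ge> 0\<close> and \<open>\<epsilon> V' \<ge> 0\<close>, and its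
  Lorentzian norm is \<open>2 sqrt (U' V') / (\<Delta> y)\<close>. So points with \<open>\<epsilon> U < 0\<close> or \<open>\<epsilon> V < 0\<close> cannot be
  reached from the identity.

  Distances are bounded from above by calibrations: for each \<open>\<theta>\<close> in \<open>(0, 1)\<close> such that \<open>\<theta> + U\<close> and
  \<open>1 - \<theta> + V\<close> are positive at the endpoint, the function
  \<open>\<Phi> = \<epsilon> ln ((\<theta> + U) (1 - \<theta> + V) / y)\<close> solves the eikonal equation \<open>\<Phi>\<^sub>U \<Phi>\<^sub>V = 1 / y\<^sup>2\<close>, and since
  \<open>y = (\<theta> + U) + (1 - \<theta> + V)\<close>, the inequality of arithmetic and geometric means says that \<open>\<Delta>\<close>
  times the length of a future curve is at most the increment of \<open>\<Phi>\<close> (\<open>calibration_inequality\<close>,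
  \<open>calibrated_integral_bound\<close>). The curves are merely Lipschitz, so this needs the fundamental
  theorem of calculus for Lipschitz functions (\<open>lipschitz_has_integral_derivative\<close>). Equality holds
  along the curve on which \<open>1 / (\<theta> + U) - 1 / (1 - \<theta> + V)\<close> is constant. For an endpoint \<open>(P, Q)\<close>
  with \<open>\<epsilon> P, \<epsilon> Q > 0\<close> there is a \<open>\<theta>\<close> for which that curve passes through it
  (\<open>optimal_calibration\<close>), hence the curve is a longest one (\<open>geodesic\<close>) and the distance \<open>\<rho>\<close>
  satisfies \<open>cosh (\<Delta> \<rho>) = 1 + 2 P Q / y\<close> (\<open>lorentz_dist_timelike\<close>). For \<open>P Q = 0\<close> the bounds tend
  to \<open>0\<close> as \<open>\<theta>\<close> approaches \<open>0\<close> or \<open>1\<close> (\<open>lorentz_dist_null\<close>).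

  In particular the distance is always finite, and it is positive exactly when \<open>\<epsilon> P, \<epsilon> Q > 0\<close>, which
  gives \<open>S(+\<infinity>)\<close> and \<open>S(0)\<close>. Since \<open>4 P Q = (y - 1)\<^sup>2 - w\<^sup>2\<close>, the distance formula becomes the
  equation of the hyperbola, and the condition on the signs of \<open>P, Q\<close> selects the branch on the side
  \<open>sgn (y - cosh \<sigma>) = \<epsilon>\<close> (\<open>hyperbola_branch_iff\<close>). That branch is a graph over \<open>w\<close>: over the whole
  line with \<open>y \<rightarrow> \<infinity>\<close> if \<open>\<epsilon> = 1\<close>, and over \<open>(-1, 1)\<close> with \<open>y \<rightarrow> 0\<close> at both ends if \<open>\<epsilon> = -1\<close>
  (\<open>arc_noncompact_hyperbola_branch\<close>).
\<close>

section \<open>Calculus of Lipschitz functions\<close>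

lemma has_real_derivative_imp_quotients_LIMSEQ:
  fixes f :: "real \<Rightarrow> real"
  assumes "(f has_real_derivative D) (at x within S)"
    and "\<And>k. x + h k \<in> S" "\<And>k. h k \<noteq> 0" "h \<longlonglongrightarrow> 0"
  shows "(\<lambda>k. (f (x + h k) - f x) / h k) \<longlonglongrightarrow> D"
proof -
  have "((\<lambda>y. (f y - f x) / (y - x)) \<longlongrightarrow> D) (at x within S)"
    using assms(1) by (simp add: has_field_derivative_iff)
  moreover have "filterlim (\<lambda>k. x + h k) (at x within S) sequentially"
    unfolding filterlim_at using assms(2-3) tendsto_add[OF tendsto_const assms(4), of x]
    by auto
  ultimately have "(\<lambda>k. (f (x + h k) - f x) / (x + h k - x)) \<longlonglongrightarrow> D"
    by (rule filterlim_compose)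
  then show ?thesis by simp
qed

text \<open>
  The difference quotients of a Lipschitz function are bounded by the Lipschitz constant, so they may
  be integrated to the limit by dominated convergence. Their integrals telescope to averages of the
  function over short intervals next to the endpoints, which converge by continuity.
\<close>

lemma lipschitz_has_integral_derivative:
  fixes f f' :: "real \<Rightarrow> real"
  assumes "a \<le> b" and lip: "L-lipschitz_on {a..b} f" and "negligible N"
    and deriv: "\<And>x. x \<in> {a..b} - N \<Longrightarrow> (f has_real_derivative f' x) (at x)"
  shows "(f' has_integral f b - f a) {a..b}"
proof -
  \<comment> \<open>Extension by constants, so that forward difference quotients make sense up to \<open>b\<close>.\<close>
  define F where "F x = f (max a (min b x))" for x
  define h where "h k = 1 / real (Suc k)" for k
  have h: "0 < h k" "h k \<le> 1" "h k \<noteq> 0" for k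
    by (auto simp: h_def)
  have h0: "h \<longlonglongrightarrow> 0"
    unfolding h_def by (rule LIMSEQ_Suc[OF lim_1_over_n])
  have "L \<ge> 0"
    using lip by (rule lipschitz_on_nonneg)
  have lipF: "\<bar>F x - F y\<bar> \<le> L * \<bar>x - y\<bar>" for x y
  proof -
    have "\<bar>F x - F y\<bar> \<le> L * \<bar>max a (min b x) - max a (min b y)\<bar>"
      unfolding F_def using lipschitz_onD[OF lip] \<open>a \<le> b\<close>
      by (auto simp: dist_real_def)
    also have "\<dots> \<le> L * \<bar>x - y\<bar>"
      using \<open>L \<ge> 0\<close> by (intro mult_left_mono) auto
    finally show ?thesis .
  qed
  have "L-lipschitz_on UNIV F"
    using lipF \<open>L \<ge> 0\<close> by (auto simp: lipschitz_on_def dist_real_def)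
  then have cont: "continuous_on S F" for S
    using lipschitz_on_continuous_on continuous_on_subset by blast
  define G where "G x = integral {a..x} F" for x
  have G: "integral {x..y} F = G y - G x" if "a \<le> x" "x \<le> y" for x y
    using Henstock_Kurzweil_Integration.integral_combine
      [OF that integrable_continuous_real[OF cont]]
    by (simp add: G_def)
  have G': "(\<lambda>k. (G (x + h k) - G x) / h k) \<longlonglongrightarrow> F x" if "x \<in> {a..b}" for x
  proof -
    have "x + h k \<in> {a..b + 1}" for k
      using that h(1,2)[of k] by simp
    then show ?thesis
      unfolding G_def using that h(3) h0
      by (intro has_real_derivative_imp_quotients_LIMSEQ[where S = "{a..b + 1}"]
          integral_has_real_derivative cont) auto
  qed
  define q where "q k x = (F (x + h k) - F x) / h k" for k x
  have q_int: "(q k has_integral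
      (G (b + h k) - G b) / h k - (G (a + h k) - G a) / h k) {a..b}" for k
  proof -
    have "((\<lambda>x. F (x + h k)) has_integral integral {a + h k..b + h k} F) {a..b}"
      using has_integral_shift_Icc_real[of F "h k" "integral {a + h k..b + h k} F" a b]
        integrable_integral[OF integrable_continuous_real[OF cont]]
      by (simp add: o_def add.commute)
    then have "((\<lambda>x. F (x + h k)) has_integral G (b + h k) - G (a + h k)) {a..b}"
      using G[of "a + h k" "b + h k"] h(1)[of k] \<open>a \<le> b\<close> by simp
    moreover have "(F has_integral G b - G a) {a..b}"
      using integrable_integral[OF integrable_continuous_real[OF cont, of a b]] G[of a b] \<open>a \<le> b\<close>
      by simp
    ultimately have "((\<lambda>x. (F (x + h k) - F x) / h k) has_integral
        ((G (b + h k) - G (a + h k)) - (G b - G a)) / h k) {a..b}"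
      by (intro has_integral_divide has_integral_diff)
    then show ?thesis
      by (simp add: q_def[abs_def] diff_divide_distrib add_divide_distrib algebra_simps)
  qed
  \<comment> \<open>At the endpoints the extended function need not be differentiable.\<close>
  define N' where "N' = N \<union> {a, b}"
  have N': "negligible N'"
    using \<open>negligible N\<close> by (simp add: N'_def negligible_Un)
  \<comment> \<open>Convergence is required everywhere, so the quotients are set to \<open>0\<close> on the exceptional set.\<close>
  define q0 where "q0 k x = (if x \<in> N' then 0 else q k x)" for k x
  define g where "g x = (if x \<in> N' then 0 else f' x)" for x
  have q0_int: "(q0 k has_integral
      (G (b + h k) - G b) / h k - (G (a + h k) - G a) / h k) {a..b}" for k
    by (rule has_integral_spike[OF N' _ q_int]) (simp add: q0_def)
  have bound: "norm (q0 k x) \<le> L" for k x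
    using lipF[of "x + h k" x] h(1)[of k] \<open>L \<ge> 0\<close>
    by (auto simp: q0_def q_def divide_simps)
  have conv: "(\<lambda>k. q0 k x) \<longlonglongrightarrow> g x" if "x \<in> {a..b}" for x
  proof (cases "x \<in> N'")
    case False
    then have x: "x \<in> {a<..<b}" "x \<in> {a..b} - N"
      using that by (auto simp: N'_def)
    have "(F has_real_derivative f' x) (at x)"
      by (rule has_field_derivative_transform_within_open
          [OF deriv[OF x(2)] open_greaterThanLessThan x(1)]) (auto simp: F_def)
    then have "(\<lambda>k. q k x) \<longlonglongrightarrow> f' x"
      unfolding q_def using h(3) h0 by (intro has_real_derivative_imp_quotients_LIMSEQ) auto
    with False show ?thesis
      by (simp add: q0_def g_def)
  qed (simp add: q0_def g_def)
  note dc = dominated_convergence[of q0 "{a..b}" "\<lambda>_. L" g,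
      OF has_integral_integrable[OF q0_int] integrable_const_ivl bound conv]
  have "(\<lambda>k. integral {a..b} (q0 k)) \<longlonglongrightarrow> F b - F a"
    unfolding integral_unique[OF q0_int] using \<open>a \<le> b\<close> by (intro tendsto_diff G') auto
  with dc(2) have "integral {a..b} g = F b - F a"
    by (rule LIMSEQ_unique)
  with dc(1) have "(g has_integral F b - F a) {a..b}"
    by (simp add: has_integral_integrable_integral)
  then have "(f' has_integral F b - F a) {a..b}"
    by (rule has_integral_spike[OF N', rotated]) (simp add: g_def)
  with \<open>a \<le> b\<close> show ?thesis
    by (simp add: F_def)
qed

lemma has_vector_derivative_continuous_imp_lipschitz:
  fixes f :: "real \<Rightarrow> 'a::real_normed_vector"
  assumes "\<And>x. x \<in> {a..b} \<Longrightarrow> (f has_vector_derivative f' x) (at x)"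
    and "continuous_on {a..b} f'"
  shows "\<exists>L. L-lipschitz_on {a..b} f"
proof -
  have "bounded (f' ` {a..b})"
    by (intro compact_imp_bounded compact_continuous_image assms) auto
  then obtain B where B: "B > 0" "\<And>x. x \<in> {a..b} \<Longrightarrow> norm (f' x) \<le> B"
    by (auto simp: bounded_pos)
  have "B-lipschitz_on {a..b} f"
  proof (rule bounded_derivative_imp_lipschitz[where f' = "\<lambda>x h. h *\<^sub>R f' x"])
    show "(f has_derivative (\<lambda>h. h *\<^sub>R f' x)) (at x within {a..b})" if "x \<in> {a..b}" for x
      using assms(1)[OF that] has_vector_derivative_at_within has_vector_derivative_def by blast
    show "onorm (\<lambda>h. h *\<^sub>R f' x) \<le> B" if "x \<in> {a..b}" for x
      using B(2)[OF that] by (intro onorm_le) (simp add: mult.commute[of B] mult_left_mono)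
  qed (use B in auto)
  then show ?thesis ..
qed

lemma lipschitz_on_ln:
  fixes f :: "real \<Rightarrow> real"
  assumes "L-lipschitz_on {a..b} f" and pos: "\<And>x. x \<in> {a..b} \<Longrightarrow> f x > 0"
  shows "\<exists>L. L-lipschitz_on {a..b} (\<lambda>x. ln (f x))"
proof (cases "a \<le> b")
  case True
  have "continuous_on {a..b} f"
    using assms(1) by (rule lipschitz_on_continuous_on)
  then obtain x0 where x0: "x0 \<in> {a..b}" "\<And>x. x \<in> {a..b} \<Longrightarrow> f x0 \<le> f x"
    using continuous_attains_inf[of "{a..b}" f] True by auto
  define m where "m = f x0"
  have m: "m > 0" "\<And>x. x \<in> {a..b} \<Longrightarrow> m \<le> f x"
    using x0 pos by (auto simp: m_def)
  have "(1 / m)-lipschitz_on {m..} (ln :: real \<Rightarrow> real)"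
  proof (rule bounded_derivative_imp_lipschitz[where f' = "\<lambda>x h. h *\<^sub>R (1 / x)"])
    show "(ln has_derivative (\<lambda>h. h *\<^sub>R (1 / x))) (at x within {m..})" if "x \<in> {m..}" for x
      using that m(1) by (auto intro!: derivative_eq_intros simp: field_simps)
    show "onorm (\<lambda>h. h *\<^sub>R (1 / x)) \<le> 1 / m" if "x \<in> {m..}" for x :: real
      using that m(1) by (intro onorm_le) (auto simp: divide_simps mult_left_mono)
  qed (use m in auto)
  then have "(1 / m)-lipschitz_on (f ` {a..b}) (ln :: real \<Rightarrow> real)"
    by (rule lipschitz_on_subset) (use m in auto)
  from lipschitz_on_compose[OF assms(1) this] show ?thesis
    by (auto simp: o_def)
qed (auto intro: exI[of _ 0])

lemma lipschitz_derivative_nonneg_imp_mono: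
  fixes f f' :: "real \<Rightarrow> real"
  assumes lip: "L-lipschitz_on {a..b} f" and "negligible N"
    and deriv: "\<And>x. x \<in> {a..b} - N \<Longrightarrow> (f has_real_derivative f' x) (at x)"
    and nonneg: "\<And>x. x \<in> {a..b} - N \<Longrightarrow> f' x \<ge> 0"
    and "a \<le> x" "x \<le> y" "y \<le> b"
  shows "f x \<le> f y"
proof -
  define g where "g r = (if r \<in> N then 0 else f' r)" for r
  have "(f' has_integral f y - f x) {x..y}"
    using assms by (intro lipschitz_has_integral_derivative[where N = N and L = L])
      (auto intro: lipschitz_on_subset[OF lip])
  then have "(g has_integral f y - f x) {x..y}"
    by (rule has_integral_spike[OF \<open>negligible N\<close>, rotated]) (simp add: g_def)
  then have "0 \<le> f y - f x"
    by (rule has_integral_nonneg) (use assms in \<open>auto simp: g_def\<close>)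
  then show ?thesis by simp
qed

section \<open>Calibrations\<close>

text \<open>
  The right-hand side equals \<open>e (p n / m + q m / n) / (m + n)\<close>, so that this is the inequality of
  arithmetic and geometric means. Here \<open>(p, q)\<close> is a velocity in null coordinates, \<open>m\<close> and \<open>n\<close> stand
  for \<open>\<theta> + U\<close> and \<open>1 - \<theta> + V\<close>, and the right-hand side is the derivative of the calibrating function.
\<close>

lemma calibration_inequality:
  fixes m n p q e :: real
  assumes "m > 0" "n > 0" "e * e = 1" "e * p \<ge> 0" "e * q \<ge> 0"
  shows "2 * sqrt (p * q) / (m + n) \<le> e * (p / m + q / n - (p + q) / (m + n))"
proof -
  have "sqrt (p * q) = sqrt ((e * p * n / m) * (e * q * m / n))"
    using assms by (simp add: field_simps)
  also have "\<dots> \<le> ((e * p * n / m) + (e * q * m / n)) / 2"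
    using assms by (intro arith_geo_mean_sqrt) auto
  finally have "2 * sqrt (p * q) / (m + n) \<le> (e * p * n / m + e * q * m / n) / (m + n)"
    using assms by (intro divide_right_mono) auto
  also have "\<dots> = e * (p / m + q / n - (p + q) / (m + n))"
    using assms(1-2) by (simp add: divide_simps) (simp add: algebra_simps)
  finally show ?thesis .
qed

text \<open>
  Positivity of \<open>\<theta> + u\<close> and \<open>1 - \<theta> + v\<close> at both ends is enough: \<open>e u\<close> and \<open>e v\<close> are nondecreasing, so
  these quantities stay between their initial and final values. Hence the logarithms in the
  calibrating function stay defined along the curve, and the pointwise inequality can be integrated.
  The factor \<open>k\<close> is there for the constant \<open>1 / \<Delta>\<close> in the length.
\<close>

lemma calibrated_integral_bound:
  fixes u v u' v' :: "real \<Rightarrow> real"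
  assumes e: "e * e = 1" and \<theta>: "0 < \<theta>" "\<theta> < 1" and "k \<ge> 0" and "a \<le> b"
    and lip: "L-lipschitz_on {a..b} u" "M-lipschitz_on {a..b} v" and N: "negligible N"
    and deriv: "\<And>r. r \<in> {a..b} - N \<Longrightarrow> (u has_real_derivative u' r) (at r)"
      "\<And>r. r \<in> {a..b} - N \<Longrightarrow> (v has_real_derivative v' r) (at r)"
    and future: "\<And>r. r \<in> {a..b} - N \<Longrightarrow> e * u' r \<ge> 0"
      "\<And>r. r \<in> {a..b} - N \<Longrightarrow> e * v' r \<ge> 0"
    and start: "u a = 0" "v a = 0"
    and stop: "\<theta> + u b > 0" "1 - \<theta> + v b > 0"
  shows "(\<integral>\<^sup>+ r \<in> {a..b}. ennreal (k * (2 * sqrt (u' r * v' r) / (1 + u r + v r))) \<partial>lebesgue)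
    \<le> ennreal (k * (e * ln ((\<theta> + u b) * (1 - \<theta> + v b) / (\<theta> * (1 - \<theta>) * (1 + u b + v b)))))"
proof -
  have e_cases: "e = 1 \<or> e = - 1"
    using e by (simp add: square_eq_1_iff)
  have lip_e: "(\<bar>e\<bar> * L)-lipschitz_on {a..b} (\<lambda>r. e * u r)"
    "(\<bar>e\<bar> * M)-lipschitz_on {a..b} (\<lambda>r. e * v r)"
    using lip by (intro lipschitz_on_cmult_real; simp)+
  have deriv_e: "((\<lambda>r. e * u r) has_real_derivative e * u' r) (at r)"
    "((\<lambda>r. e * v r) has_real_derivative e * v' r) (at r)" if "r \<in> {a..b} - N" for r
    using deriv[OF that] by (auto intro!: derivative_eq_intros)
  have mono_u: "e * u x \<le> e * u y" if "a \<le> x" "x \<le> y" "y \<le> b" for x y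
    using lipschitz_derivative_nonneg_imp_mono[OF lip_e(1) N deriv_e(1) future(1) that] by simp
  have mono_v: "e * v x \<le> e * v y" if "a \<le> x" "x \<le> y" "y \<le> b" for x y
    using lipschitz_derivative_nonneg_imp_mono[OF lip_e(2) N deriv_e(2) future(2) that] by simp
  define m where "m r = \<theta> + u r" for r
  define n where "n r = 1 - \<theta> + v r" for r
  have m_pos: "m r > 0" if "r \<in> {a..b}" for r
    using mono_u[of a r] mono_u[of r b] that e_cases \<theta> start stop by (auto simp: m_def)
  have n_pos: "n r > 0" if "r \<in> {a..b}" for r
    using mono_v[of a r] mono_v[of r b] that e_cases \<theta> start stop by (auto simp: n_def)
  have y: "1 + u r + v r = m r + n r" for r
    by (simp add: m_def n_def)
  define \<Phi> where "\<Phi> r = e * (ln (m r) + ln (n r) - ln (m r + n r))" for r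
  define g where "g r = e * (u' r / m r + v' r / n r - (u' r + v' r) / (m r + n r))" for r
  have lip_mn: "(0 + L)-lipschitz_on {a..b} m" "(0 + M)-lipschitz_on {a..b} n"
    unfolding m_def n_def by (intro lipschitz_on_add lipschitz_on_constant lip)+
  obtain L1 L2 L3 where "L1-lipschitz_on {a..b} (\<lambda>r. ln (m r))"
    "L2-lipschitz_on {a..b} (\<lambda>r. ln (n r))" "L3-lipschitz_on {a..b} (\<lambda>r. ln (m r + n r))"
    using lipschitz_on_ln[OF lip_mn(1) m_pos] lipschitz_on_ln[OF lip_mn(2) n_pos]
      lipschitz_on_ln[OF lipschitz_on_add[OF lip_mn] add_pos_pos[OF m_pos n_pos]] by blast
  then have lip_\<Phi>: "(\<bar>e\<bar> * (L1 + L2 + L3))-lipschitz_on {a..b} \<Phi>"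
    unfolding \<Phi>_def
    by (intro lipschitz_on_cmult_real lipschitz_on_diff lipschitz_on_add)
  have deriv_\<Phi>: "(\<Phi> has_real_derivative g r) (at r)" if r: "r \<in> {a..b} - N" for r
  proof -
    have mn: "(m has_real_derivative u' r) (at r)" "(n has_real_derivative v' r) (at r)"
      unfolding m_def n_def using deriv[OF r] by (auto intro!: derivative_eq_intros)
    show ?thesis
      unfolding \<Phi>_def g_def using m_pos[of r] n_pos[of r] r
      by (auto intro!: derivative_eq_intros mn simp: divide_simps) 
  qed
  have "(g has_integral \<Phi> b - \<Phi> a) {a..b}"
    by (rule lipschitz_has_integral_derivative[OF \<open>a \<le> b\<close> lip_\<Phi> N deriv_\<Phi>])
  then have "((\<lambda>r. if r \<in> N then 0 else g r) has_integral \<Phi> b - \<Phi> a) {a..b}"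
    by (rule has_integral_spike[OF N, rotated]) simp
  then have int: "((\<lambda>r. k * (if r \<in> N then 0 else g r)) has_integral k * (\<Phi> b - \<Phi> a)) {a..b}"
    by (rule has_integral_mult_right)
  have le_g: "2 * sqrt (u' r * v' r) / (1 + u r + v r) \<le> g r" if "r \<in> {a..b} - N" for r
    unfolding y g_def using that m_pos[of r] n_pos[of r] future[OF that] e
    by (intro calibration_inequality) auto
  have density_nonneg: "0 \<le> 2 * sqrt (u' r * v' r) / (1 + u r + v r)" if "r \<in> {a..b} - N" for r
  proof -
    have "0 \<le> (e * u' r) * (e * v' r)"
      using future[OF that] by (rule mult_nonneg_nonneg)
    also have "\<dots> = (e * e) * (u' r * v' r)"
      by (simp add: algebra_simps)
    also have "\<dots> = u' r * v' r"
      using e by simp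
    finally show ?thesis
      unfolding y using that m_pos[of r] n_pos[of r] by (intro divide_nonneg_pos) auto
  qed
  have "(\<integral>\<^sup>+ r \<in> {a..b}. ennreal (k * (2 * sqrt (u' r * v' r) / (1 + u r + v r))) \<partial>lebesgue)
      \<le> (\<integral>\<^sup>+ r. ennreal (k * (if r \<in> N then 0 else g r)) * indicator {a..b} r \<partial>lebesgue)"
  proof (rule nn_integral_mono_AE)
    have "AE r in lebesgue. r \<notin> N"
      using N by (simp add: AE_not_in negligible_iff_null_sets)
    then show "AE r in lebesgue.
        ennreal (k * (2 * sqrt (u' r * v' r) / (1 + u r + v r))) * indicator {a..b} r
        \<le> ennreal (k * (if r \<in> N then 0 else g r)) * indicator {a..b} r"
    proof eventually_elim
      case (elim r)
      then show ?case
        using le_g[of r] \<open>k \<ge> 0\<close>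
        by (auto simp: indicator_def simp del: times_divide_eq_right
            intro!: ennreal_leI mult_left_mono)
    qed
  qed
  also have "\<dots> = ennreal (k * (\<Phi> b - \<Phi> a))"
  proof -
    have "0 \<le> k * (if r \<in> N then 0 else g r)" if "r \<in> {a..b}" for r
      using le_g[of r] density_nonneg[of r] that \<open>k \<ge> 0\<close> by auto
    from nn_integral_has_integral_lebesgue'[OF this int] show ?thesis
      by (simp add: nn_integral_completion)
  qed
  also have "\<Phi> b - \<Phi> a = e * ln ((\<theta> + u b) * (1 - \<theta> + v b) / (\<theta> * (1 - \<theta>) * (1 + u b + v b)))"
  proof -
    have "m a = \<theta>" "n a = 1 - \<theta>"
      using start by (auto simp: m_def n_def)
    moreover have "ln (m b * n b / (\<theta> * (1 - \<theta>) * (m b + n b))) =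
        ln (m b) + ln (n b) - (ln \<theta> + ln (1 - \<theta>) + ln (m b + n b))"
      using m_pos[of b] n_pos[of b] \<theta> \<open>a \<le> b\<close> by (simp add: ln_div ln_mult_pos)
    ultimately show ?thesis
      unfolding \<Phi>_def y m_def[of b, symmetric] n_def[of b, symmetric]
      by (simp only: diff_add_cancel) (simp add: right_diff_distrib distrib_left)
  qed
  finally show ?thesis .
qed

text \<open>
  Here \<open>m' / m\<^sup>2 = n' / n\<^sup>2 = e\<close>, which is the equality case of the calibration inequality: both sides are
  \<open>2 m n / (m + n)\<close>, the derivative of \<open>e ln (m n / (m + n))\<close>.
\<close>

lemma calibrated_geodesic:
  fixes \<theta> e :: real
  assumes e: "e * e = 1" and \<theta>: "0 < \<theta>" "\<theta> < 1" and "T \<ge> 0"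
    and pos: "1 / \<theta> - e * T > 0" "1 / (1 - \<theta>) - e * T > 0"
  defines "m \<equiv> \<lambda>r. 1 / (1 / \<theta> - e * r)" and "n \<equiv> \<lambda>r. 1 / (1 / (1 - \<theta>) - e * r)"
  shows "\<And>r. r \<in> {0..T} \<Longrightarrow> m r > 0" "\<And>r. r \<in> {0..T} \<Longrightarrow> n r > 0"
    and "\<And>r. r \<in> {0..T} \<Longrightarrow> (m has_real_derivative e * (m r)\<^sup>2) (at r)"
    and "\<And>r. r \<in> {0..T} \<Longrightarrow> (n has_real_derivative e * (n r)\<^sup>2) (at r)"
    and "((\<lambda>r. 2 * (m r * n r) / (m r + n r)) has_integral
      e * ln (m T * n T / (\<theta> * (1 - \<theta>) * (m T + n T)))) {0..T}"
proof -
  have e_cases: "e = 1 \<or> e = - 1"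
    using e by (simp add: square_eq_1_iff)
  have "e * r \<le> max 0 (e * T)" if "r \<in> {0..T}" for r
    using e_cases that by auto
  then have den: "1 / \<theta> - e * r > 0" "1 / (1 - \<theta>) - e * r > 0" if "r \<in> {0..T}" for r
    using pos \<theta> that by (smt (verit) divide_pos_pos)+
  then show m_pos: "m r > 0" and n_pos: "n r > 0" if "r \<in> {0..T}" for r
    using that by (auto simp: m_def n_def)
  show m': "(m has_real_derivative e * (m r)\<^sup>2) (at r)"
    and n': "(n has_real_derivative e * (n r)\<^sup>2) (at r)" if "r \<in> {0..T}" for r
    unfolding m_def n_def using den[OF that]
    by (auto intro!: derivative_eq_intros simp: power2_eq_square)
  define \<Phi> where "\<Phi> r = e * (ln (m r) + ln (n r) - ln (m r + n r))" for r
  have "(\<Phi> has_real_derivative 2 * (m r * n r) / (m r + n r)) (at r)" if r: "r \<in> {0..T}" for r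
  proof -
    have "(\<Phi> has_real_derivative e * (1 / m r * (e * (m r)\<^sup>2) + 1 / n r * (e * (n r)\<^sup>2)
        - 1 / (m r + n r) * (e * (m r)\<^sup>2 + e * (n r)\<^sup>2))) (at r)"
      unfolding \<Phi>_def using m_pos[OF r] n_pos[OF r]
      by (auto intro!: derivative_eq_intros m'[OF r] n'[OF r])
    also have "e * (1 / m r * (e * (m r)\<^sup>2) + 1 / n r * (e * (n r)\<^sup>2)
        - 1 / (m r + n r) * (e * (m r)\<^sup>2 + e * (n r)\<^sup>2)) =
        (e * e) * (m r + n r - ((m r)\<^sup>2 + (n r)\<^sup>2) / (m r + n r))"
      using m_pos[OF r] n_pos[OF r] by (simp add: field_simps power2_eq_square)
    also have "\<dots> = 2 * (m r * n r) / (m r + n r)"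
      using m_pos[OF r] n_pos[OF r] unfolding e by (simp add: field_simps power2_eq_square)
    finally show ?thesis .
  qed
  then have "((\<lambda>r. 2 * (m r * n r) / (m r + n r)) has_integral \<Phi> T - \<Phi> 0) {0..T}"
    using \<open>T \<ge> 0\<close>
    by (intro fundamental_theorem_of_calculus)
      (auto simp flip: has_real_derivative_iff_has_vector_derivative
        intro: has_field_derivative_at_within)
  also have "\<Phi> T - \<Phi> 0 = e * ln (m T * n T / (\<theta> * (1 - \<theta>) * (m T + n T)))"
  proof -
    have mn0: "m 0 = \<theta>" "n 0 = 1 - \<theta>"
      using \<theta> by (auto simp: m_def n_def)
    have ln_eq: "ln (m T * n T / (\<theta> * (1 - \<theta>) * (m T + n T))) =
        ln (m T) + ln (n T) - (ln \<theta> + ln (1 - \<theta>) + ln (m T + n T))"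
      using m_pos[of T] n_pos[of T] \<theta> \<open>T \<ge> 0\<close> by (simp add: ln_div ln_mult_pos)
    show ?thesis
      unfolding \<Phi>_def mn0 ln_eq by (simp add: algebra_simps)
  qed
  finally show "((\<lambda>r. 2 * (m r * n r) / (m r + n r)) has_integral
      e * ln (m T * n T / (\<theta> * (1 - \<theta>) * (m T + n T)))) {0..T}" .
qed

text \<open>
  The equation says \<open>1 / \<theta> - 1 / (\<theta> + P) = 1 / (1 - \<theta>) - 1 / (1 - \<theta> + Q)\<close>: both factors of the
  calibrating function, moving as in \<open>calibrated_geodesic\<close>, need the same time to reach the values
  that they have at the endpoint.
\<close>

lemma optimal_calibration:
  fixes P Q e :: real
  assumes e: "e = 1 \<or> e = - 1" and P: "e * P > 0" and Q: "e * Q > 0" and Y: "1 + P + Q > 0"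
  obtains \<theta> where "0 < \<theta>" "\<theta> < 1" "\<theta> + P > 0" "1 - \<theta> + Q > 0"
    "P * (1 - \<theta>) * (1 - \<theta> + Q) = Q * \<theta> * (\<theta> + P)"
proof -
  \<comment> \<open>The intermediate value theorem, on \<open>[0, 1]\<close> or on \<open>[- P, 1 + Q]\<close>: there \<open>\<theta>\<close>, \<open>1 - \<theta>\<close>, \<open>\<theta> + P\<close> and \<open>1 - \<theta> + Q\<close> are nonnegative.\<close>
  define g where "g \<theta> = P * (1 - \<theta>) * (1 - \<theta> + Q) - Q * \<theta> * (\<theta> + P)" for \<theta>
  have cont: "continuous_on S g" for S
    unfolding g_def by (intro continuous_intros)
  from e show ?thesis
  proof
    assume "e = 1"
    then have "g 0 > 0" "g 1 < 0"
      using P Q by (auto simp: g_def)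
    then obtain \<theta> where "0 \<le> \<theta>" "\<theta> \<le> 1" "g \<theta> = 0"
      using IVT2'[of g 1 0 0] cont by force
    moreover from this \<open>g 0 > 0\<close> \<open>g 1 < 0\<close> have "\<theta> \<noteq> 0" "\<theta> \<noteq> 1"
      by auto
    ultimately show ?thesis
      using that[of \<theta>] P Q \<open>e = 1\<close> by (simp add: g_def)
  next
    assume "e = - 1"
    then have neg: "P < 0" "Q < 0"
      using P Q by auto
    have "g (- P) = P * (1 + P) * (1 + P + Q)" "g (1 + Q) = - Q * (1 + Q) * (1 + P + Q)"
      by (auto simp: g_def algebra_simps)
    then have "g (- P) < 0" "g (1 + Q) > 0"
      using neg Y by (auto simp: mult_less_0_iff zero_less_mult_iff)
    then obtain \<theta> where "- P \<le> \<theta>" "\<theta> \<le> 1 + Q" "g \<theta> = 0"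
      using IVT'[of g "- P" 0 "1 + Q"] cont Y by force
    moreover from this \<open>g (- P) < 0\<close> \<open>g (1 + Q) > 0\<close> have "\<theta> \<noteq> - P" "\<theta> \<noteq> 1 + Q"
      by auto
    ultimately show ?thesis
      using that[of \<theta>] neg by (simp add: g_def)
  qed
qed

text \<open>
  With \<open>X\<close> and \<open>Z\<close> the denominator and numerator below, the optimality equation makes the two
  summands of \<open>Z - X\<close> equal, namely \<open>Q \<theta> (\<theta> + P)\<close> and \<open>P (1 - \<theta>) (1 - \<theta> + Q)\<close>. Thus
  \<open>(Z - X)\<^sup>2\<close> is four times their product, and \<open>cosh (ln (Z / X)) = 1 + (Z - X)\<^sup>2 / (2 X Z)\<close>.
\<close>

lemma optimal_calibration_value:
  fixes P Q \<theta> :: real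
  assumes \<theta>: "0 < \<theta>" "\<theta> < 1" "\<theta> + P > 0" "1 - \<theta> + Q > 0"
    and opt: "P * (1 - \<theta>) * (1 - \<theta> + Q) = Q * \<theta> * (\<theta> + P)"
  shows "cosh (ln ((\<theta> + P) * (1 - \<theta> + Q) / (\<theta> * (1 - \<theta>) * (1 + P + Q)))) =
    1 + 2 * P * Q / (1 + P + Q)"
proof -
  define Y where "Y = 1 + P + Q"
  define X where "X = \<theta> * (1 - \<theta>) * Y"
  define Z where "Z = (\<theta> + P) * (1 - \<theta> + Q)"
  have "Y > 0"
    using \<theta>(3,4) by (simp add: Y_def)
  then have pos: "X > 0" "Z > 0"
    using \<theta> by (auto simp: X_def Z_def)
  have ZX: "Z - X = \<theta> * \<theta> * Q + (1 - \<theta>) * (1 - \<theta>) * P + P * Q"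
    by (simp add: X_def Y_def Z_def algebra_simps)
  have "Z - X = 2 * (Q * \<theta> * (\<theta> + P))"
    unfolding ZX using opt by (simp add: algebra_simps)
  moreover have "Z - X = 2 * (P * (1 - \<theta>) * (1 - \<theta> + Q))"
    unfolding ZX using opt by (simp add: algebra_simps)
  ultimately have "(Z - X) * (Z - X) =
      (2 * (Q * \<theta> * (\<theta> + P))) * (2 * (P * (1 - \<theta>) * (1 - \<theta> + Q)))"
    by simp
  then have sq: "(Z - X) * (Z - X) * Y = 4 * P * Q * (X * Z)"
    unfolding X_def Z_def by algebra
  have "cosh (ln (Z / X)) = (Z / X + X / Z) / 2"
    using pos by (simp add: cosh_ln_real)
  also have "\<dots> = 1 + (Z - X) * (Z - X) / (2 * (X * Z))"
    using pos by (simp add: field_simps)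
  also have "(Z - X) * (Z - X) = 4 * P * Q * (X * Z) / Y"
    using sq \<open>Y > 0\<close> by (simp add: field_simps)
  also have "4 * P * Q * (X * Z) / Y / (2 * (X * Z)) = 2 * P * Q / Y"
    using pos by simp
  finally show ?thesis
    by (simp add: X_def Y_def Z_def)
qed

section \<open>Null coordinates\<close>

text \<open>
  The sectional curvature is \<open>(c\<^sup>2 - a\<^sup>2) / |A|\<^sup>2\<close>, so its positivity amounts to \<open>|a| < |c|\<close>.
\<close>

locale positive_curvature =
  fixes A :: "real^2^2"
  assumes det_pos: "det A > 0" and entries_less: "\<bar>A $ 1 $ 1\<bar> < \<bar>A $ 2 $ 1\<bar>"
begin

definition \<epsilon> :: real where "\<epsilon> = sgn (matrix_inv A $ 2 $ 1)"

text \<open>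
  The null coordinates \<open>U, V\<close> of a point \<open>q\<close> are \<open>null1 (q - aff_id)\<close> and \<open>null2 (q - aff_id)\<close>. Keeping
  the maps linear allows applying them to velocities as well. The factors are chosen so that
  \<open>y = 1 + U + V\<close>; \<open>null_vec\<close> is the inverse of the pair.
\<close>

definition null1 :: "real \<times> real \<Rightarrow> real" where
  "null1 W = ((A $ 2 $ 1 - A $ 1 $ 1) * fst W + (A $ 2 $ 2 - A $ 1 $ 2) * snd W) *
     (A $ 2 $ 1 + A $ 1 $ 1) / (2 * det A)"

definition null2 :: "real \<times> real \<Rightarrow> real" where
  "null2 W = - ((A $ 2 $ 1 + A $ 1 $ 1) * fst W + (A $ 2 $ 2 + A $ 1 $ 2) * snd W) *
     (A $ 2 $ 1 - A $ 1 $ 1) / (2 * det A)"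

definition null_vec :: "real \<Rightarrow> real \<Rightarrow> real \<times> real" where
  "null_vec p q = (lam A * (p - q) - nu A * (p + q), p + q)"

lemma eps_eq: "\<epsilon> = - sgn (A $ 2 $ 1)"
  using det_pos by (simp add: \<epsilon>_def matrix_inv_2 sgn_divide sgn_minus)

lemma eps_cases: "\<epsilon> = 1 \<or> \<epsilon> = - 1"
  using entries_less by (auto simp: eps_eq sgn_real_def)

lemma eps_square: "\<epsilon> * \<epsilon> = 1"
  using eps_cases by auto

lemma eps_factors:
  "\<epsilon> * (A $ 2 $ 1 + A $ 1 $ 1) < 0" "\<epsilon> * (A $ 2 $ 1 - A $ 1 $ 1) < 0"
  using entries_less by (auto simp: eps_eq sgn_real_def split: if_splits)

lemma entries_sq_less: "(A $ 1 $ 1)\<^sup>2 < (A $ 2 $ 1)\<^sup>2"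
  using entries_less by (simp flip: abs_le_square_iff not_le)

lemma Delta_square: "(Delta A)\<^sup>2 = ((A $ 2 $ 1)\<^sup>2 - (A $ 1 $ 1)\<^sup>2) / (det A)\<^sup>2"
  and Delta_pos: "Delta A > 0"
proof -
  have "(matrix_inv A $ 2 $ 1)\<^sup>2 - (matrix_inv A $ 2 $ 2)\<^sup>2 =
      ((A $ 2 $ 1)\<^sup>2 - (A $ 1 $ 1)\<^sup>2) / (det A)\<^sup>2"
    using det_pos by (simp add: matrix_inv_2 power_divide diff_divide_distrib)
  moreover have "\<dots> > 0"
    using det_pos entries_sq_less by simp
  ultimately show "(Delta A)\<^sup>2 = ((A $ 2 $ 1)\<^sup>2 - (A $ 1 $ 1)\<^sup>2) / (det A)\<^sup>2" "Delta A > 0"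
    by (simp_all add: Delta_def)
qed

lemma lam_eq: "lam A = det A / ((A $ 2 $ 1)\<^sup>2 - (A $ 1 $ 1)\<^sup>2)"
proof -
  have "matrix_inv A $ 1 $ 1 * matrix_inv A $ 2 $ 2 - matrix_inv A $ 1 $ 2 * matrix_inv A $ 2 $ 1
      = det A / (det A)\<^sup>2"
    using det_pos by (simp add: matrix_inv_2 power2_eq_square diff_divide_distrib det_2 mult.commute)
  with det_pos entries_sq_less show ?thesis
    by (simp add: lam_def Delta_square)
qed

lemma nu_eq: "nu A = (A $ 2 $ 1 * A $ 2 $ 2 - A $ 1 $ 1 * A $ 1 $ 2) /
    ((A $ 2 $ 1)\<^sup>2 - (A $ 1 $ 1)\<^sup>2)"
proof -
  have "matrix_inv A $ 1 $ 2 * matrix_inv A $ 2 $ 2 - matrix_inv A $ 1 $ 1 * matrix_inv A $ 2 $ 1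
      = (A $ 2 $ 1 * A $ 2 $ 2 - A $ 1 $ 1 * A $ 1 $ 2) / (det A)\<^sup>2"
    using det_pos by (simp add: matrix_inv_2 power2_eq_square diff_divide_distrib mult.commute)
  with det_pos entries_sq_less show ?thesis
    by (simp add: nu_def Delta_square)
qed

lemma lam_pos: "lam A > 0"
  using det_pos entries_sq_less by (simp add: lam_eq)

lemma null_sum: "null1 W + null2 W = snd W"
  using det_pos by (simp add: null1_def null2_def field_simps) (simp add: det_2 algebra_simps)

lemma null_diff: "null1 W - null2 W = (fst W + nu A * snd W) / lam A"
proof -
  define k where "k = (A $ 2 $ 1)\<^sup>2 - (A $ 1 $ 1)\<^sup>2"
  have "k > 0"
    using entries_sq_less by (simp add: k_def)
  have "(fst W + nu A * snd W) / lam A =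
      (k * fst W + (A $ 2 $ 1 * A $ 2 $ 2 - A $ 1 $ 1 * A $ 1 $ 2) * snd W) / det A"
    using \<open>k > 0\<close> det_pos by (simp add: lam_eq nu_eq k_def[symmetric] field_simps)
  also have "\<dots> = null1 W - null2 W"
    using det_pos by (simp add: null1_def null2_def k_def field_simps power2_eq_square)
  finally show ?thesis by simp
qed

lemma null_vec_coords [simp]: "null1 (null_vec p q) = p" "null2 (null_vec p q) = q"
  using null_sum[of "null_vec p q"] null_diff[of "null_vec p q"] lam_pos
  by (auto simp: null_vec_def)

lemma null_vec_null: "null_vec (null1 W) (null2 W) = W"
proof -
  have "lam A * (null1 W - null2 W) = fst W + nu A * (null1 W + null2 W)"
    using lam_pos by (simp add: null_diff null_sum)
  then show ?thesis
    by (simp add: null_vec_def null_sum prod_eq_iff)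
qed

lemma bounded_linear_null1: "bounded_linear null1" and bounded_linear_null2: "bounded_linear null2"
  by (intro linear_conv_bounded_linear[THEN iffD1] linearI;
      simp add: null1_def null2_def add_divide_distrib diff_divide_distrib algebra_simps)+

lemma frame_velocity:
  fixes W :: "real \<times> real"
  assumes "q \<in> Aff"
  defines "v \<equiv> A *v frame_coords q W"
  shows "null1 W = - (A $ 2 $ 1 + A $ 1 $ 1) * (snd q / (2 * det A)) * (v $ 1 - v $ 2)"
    and "null2 W = - (A $ 2 $ 1 - A $ 1 $ 1) * (snd q / (2 * det A)) * (v $ 1 + v $ 2)"
  using assms(1) det_pos
  by (auto simp: v_def null1_def null2_def frame_coords_def matrix_vector_mult_def sum_2 Aff_def
      field_simps)

lemma future_nonspacelike_iff:
  assumes "q \<in> Aff"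
  shows "future_nonspacelike A (frame_coords q W) \<longleftrightarrow> \<epsilon> * null1 W \<ge> 0 \<and> \<epsilon> * null2 W \<ge> 0"
proof -
  define v where "v = A *v frame_coords q W"
  define y where "y = snd q / (2 * det A)"
  have y: "y > 0"
    using assms det_pos by (auto simp: Aff_def y_def)
  define k1 where "k1 = - (\<epsilon> * (A $ 2 $ 1 + A $ 1 $ 1)) * y"
  define k2 where "k2 = - (\<epsilon> * (A $ 2 $ 1 - A $ 1 $ 1)) * y"
  have "k1 > 0" "k2 > 0"
    unfolding k1_def k2_def using eps_factors y by (intro mult_pos_pos; simp)+
  moreover have "\<epsilon> * null1 W = k1 * (v $ 1 - v $ 2)" "\<epsilon> * null2 W = k2 * (v $ 1 + v $ 2)"
    unfolding frame_velocity[OF assms] v_def y_def[symmetric] k1_def k2_def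
    by (simp_all add: algebra_simps)
  ultimately have "\<epsilon> * null1 W \<ge> 0 \<longleftrightarrow> v $ 1 - v $ 2 \<ge> 0" "\<epsilon> * null2 W \<ge> 0 \<longleftrightarrow> v $ 1 + v $ 2 \<ge> 0"
    by (simp_all add: zero_le_mult_iff)
  then show ?thesis
    unfolding future_nonspacelike_def v_def by auto
qed

lemma length_density:
  assumes "q \<in> Aff"
  shows "(let v = A *v frame_coords q W in sqrt ((v $ 1)\<^sup>2 - (v $ 2)\<^sup>2)) =
    1 / Delta A * (2 * sqrt (null1 W * null2 W) / snd q)"
proof -
  define v where "v = A *v frame_coords q W"
  define k where "k = (A $ 2 $ 1)\<^sup>2 - (A $ 1 $ 1)\<^sup>2"
  have "k > 0"
    using entries_sq_less by (simp add: k_def)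
  have y: "snd q > 0"
    using assms by (auto simp: Aff_def)
  define z where "z = snd q / (2 * det A)"
  have "null1 W * null2 W = k * z\<^sup>2 * ((v $ 1)\<^sup>2 - (v $ 2)\<^sup>2)"
    unfolding frame_velocity[OF assms] v_def k_def z_def[symmetric]
    by (simp add: power2_eq_square algebra_simps)
  also have "k = (Delta A)\<^sup>2 * (det A)\<^sup>2"
    using det_pos by (simp add: Delta_square k_def)
  also have "(Delta A)\<^sup>2 * (det A)\<^sup>2 * z\<^sup>2 = (Delta A * snd q / 2)\<^sup>2"
    using det_pos by (simp add: z_def power_divide power_mult_distrib)
  finally have "sqrt (null1 W * null2 W) =
      Delta A * snd q / 2 * sqrt ((v $ 1)\<^sup>2 - (v $ 2)\<^sup>2)"
    using Delta_pos y by (simp add: real_sqrt_mult)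
  then show ?thesis
    using Delta_pos y by (simp add: v_def Let_def field_simps)
qed

section \<open>The Lorentzian distance from the identity\<close>

text \<open>
  Replaces a curve in the group by two real functions, its null coordinates, to which the calculus of
  Lipschitz functions and the calibration bound apply.
\<close>

lemma future_curve_null_coords:
  assumes fc: "future_curve A t0 t1 c"
  defines "u \<equiv> \<lambda>r. null1 (c r - aff_id)" and "v \<equiv> \<lambda>r. null2 (c r - aff_id)"
    and "u' \<equiv> \<lambda>r. null1 (vector_derivative c (at r))"
    and "v' \<equiv> \<lambda>r. null2 (vector_derivative c (at r))"
  obtains L M N where "L-lipschitz_on {t0..t1} u" "M-lipschitz_on {t0..t1} v" "negligible N"
    "\<And>r. r \<in> {t0..t1} - N \<Longrightarrow> (u has_real_derivative u' r) (at r)"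
    "\<And>r. r \<in> {t0..t1} - N \<Longrightarrow> (v has_real_derivative v' r) (at r)"
    "\<And>r. r \<in> {t0..t1} - N \<Longrightarrow> \<epsilon> * u' r \<ge> 0" "\<And>r. r \<in> {t0..t1} - N \<Longrightarrow> \<epsilon> * v' r \<ge> 0"
proof -
  have in_Aff: "c r \<in> Aff" if "r \<in> {t0..t1}" for r
    using fc that by (auto simp: future_curve_def)
  obtain K where K: "K-lipschitz_on {t0..t1} c"
    using fc by (auto simp: future_curve_def)
  have lip: "\<exists>L. L-lipschitz_on {t0..t1} (\<lambda>r. f (c r - aff_id))"
    if f: "bounded_linear f" for f :: "real \<times> real \<Rightarrow> real"
  proof -
    obtain B where "B-lipschitz_on UNIV f"
      using bounded_linear.lipschitz_boundE[OF f] by blast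
    moreover have "(K + 0)-lipschitz_on {t0..t1} (\<lambda>r. c r - aff_id)"
      by (intro lipschitz_on_diff K lipschitz_on_constant)
    ultimately show ?thesis
      using lipschitz_on_compose2 lipschitz_on_subset subset_UNIV by blast
  qed
  have "AE r in lebesgue. r \<in> {t0..t1} \<longrightarrow> c differentiable (at r) \<and>
      future_nonspacelike A (frame_coords (c r) (vector_derivative c (at r)))"
    using fc by (simp add: future_curve_def)
  then obtain N where N': "\<And>r. r \<in> space lebesgue - N \<Longrightarrow>
      r \<in> {t0..t1} \<longrightarrow> c differentiable (at r) \<and>
      future_nonspacelike A (frame_coords (c r) (vector_derivative c (at r)))"
    and N: "N \<in> null_sets lebesgue"
    using AE_E3 by blast
  have diff: "(c has_vector_derivative vector_derivative c (at r)) (at r)"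
    and fut: "future_nonspacelike A (frame_coords (c r) (vector_derivative c (at r)))"
    if "r \<in> {t0..t1} - N" for r
    using N' that by (auto simp: vector_derivative_works[symmetric])
  have deriv: "((\<lambda>r. f (c r - aff_id)) has_real_derivative f (vector_derivative c (at r))) (at r)"
    if "bounded_linear f" "r \<in> {t0..t1} - N" for r and f :: "real \<times> real \<Rightarrow> real"
  proof -
    have "((\<lambda>r. c r - aff_id) has_vector_derivative vector_derivative c (at r)) (at r)"
      using diff[OF that(2)] by (auto intro!: derivative_eq_intros)
    from bounded_linear.has_vector_derivative[OF that(1) this] show ?thesis
      by (simp add: has_real_derivative_iff_has_vector_derivative)
  qed
  obtain L M where "L-lipschitz_on {t0..t1} u" "M-lipschitz_on {t0..t1} v"
    using lip[OF bounded_linear_null1] lip[OF bounded_linear_null2] by (auto simp: u_def v_def)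
  then show ?thesis
  proof (rule that)
    show "negligible N"
      using N by (simp add: negligible_iff_null_sets)
  qed (use deriv[OF bounded_linear_null1] deriv[OF bounded_linear_null2] fut in_Aff
      in \<open>auto simp: u_def v_def u'_def v'_def future_nonspacelike_iff\<close>)
qed

lemma snd_eq_null: "snd q = 1 + null1 (q - aff_id) + null2 (q - aff_id)"
  using null_sum[of "q - aff_id"] by (simp add: aff_id_def)

lemma null_zero [simp]: "null1 0 = 0" "null2 0 = 0"
  by (simp_all add: null1_def null2_def)

lemma future_curve_endpoint:
  assumes fc: "future_curve A t0 t1 c" and "c t0 = aff_id" "c t1 = q"
  shows "\<epsilon> * null1 (q - aff_id) \<ge> 0" "\<epsilon> * null2 (q - aff_id) \<ge> 0"
proof -
  have "t0 \<le> t1"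
    using fc by (simp add: future_curve_def)
  define u where "u = (\<lambda>r. null1 (c r - aff_id))"
  define v where "v = (\<lambda>r. null2 (c r - aff_id))"
  define u' where "u' = (\<lambda>r. null1 (vector_derivative c (at r)))"
  define v' where "v' = (\<lambda>r. null2 (vector_derivative c (at r)))"
  obtain L M N where lip: "L-lipschitz_on {t0..t1} u" "M-lipschitz_on {t0..t1} v"
    and N: "negligible N"
    and deriv: "\<And>r. r \<in> {t0..t1} - N \<Longrightarrow> (u has_real_derivative u' r) (at r)"
      "\<And>r. r \<in> {t0..t1} - N \<Longrightarrow> (v has_real_derivative v' r) (at r)"
    and fut: "\<And>r. r \<in> {t0..t1} - N \<Longrightarrow> \<epsilon> * u' r \<ge> 0" "\<And>r. r \<in> {t0..t1} - N \<Longrightarrow> \<epsilon> * v' r \<ge> 0"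
    using future_curve_null_coords[OF fc] unfolding u_def v_def u'_def v'_def by blast
  have "\<epsilon> * u t0 \<le> \<epsilon> * u t1"
    using deriv(1) fut(1) \<open>t0 \<le> t1\<close>
    by (intro lipschitz_derivative_nonneg_imp_mono[OF lipschitz_on_cmult_real[OF lip(1)] N,
          where f' = "\<lambda>r. \<epsilon> * u' r"]) (auto intro!: DERIV_cmult)
  moreover have "\<epsilon> * v t0 \<le> \<epsilon> * v t1"
    using deriv(2) fut(2) \<open>t0 \<le> t1\<close>
    by (intro lipschitz_derivative_nonneg_imp_mono[OF lipschitz_on_cmult_real[OF lip(2)] N,
          where f' = "\<lambda>r. \<epsilon> * v' r"]) (auto intro!: DERIV_cmult)
  ultimately show "\<epsilon> * null1 (q - aff_id) \<ge> 0" "\<epsilon> * null2 (q - aff_id) \<ge> 0"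
    using assms(2,3) by (simp_all add: u_def v_def)
qed

lemma lorentz_length_le:
  assumes fc: "future_curve A t0 t1 c" and ends: "c t0 = aff_id" "c t1 = q"
    and \<theta>: "0 < \<theta>" "\<theta> < 1"
  defines "P \<equiv> null1 (q - aff_id)" and "Q \<equiv> null2 (q - aff_id)"
  assumes pos: "\<theta> + P > 0" "1 - \<theta> + Q > 0"
  shows "lorentz_length A t0 t1 c \<le> ennreal (1 / Delta A *
    (\<epsilon> * ln ((\<theta> + P) * (1 - \<theta> + Q) / (\<theta> * (1 - \<theta>) * (1 + P + Q)))))"
proof -
  have "t0 \<le> t1" and in_Aff: "\<And>r. r \<in> {t0..t1} \<Longrightarrow> c r \<in> Aff"
    using fc by (auto simp: future_curve_def)
  define u where "u = (\<lambda>r. null1 (c r - aff_id))"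
  define v where "v = (\<lambda>r. null2 (c r - aff_id))"
  define u' where "u' = (\<lambda>r. null1 (vector_derivative c (at r)))"
  define v' where "v' = (\<lambda>r. null2 (vector_derivative c (at r)))"
  obtain L M N where lip: "L-lipschitz_on {t0..t1} u" "M-lipschitz_on {t0..t1} v"
    and N: "negligible N"
    and deriv: "\<And>r. r \<in> {t0..t1} - N \<Longrightarrow> (u has_real_derivative u' r) (at r)"
      "\<And>r. r \<in> {t0..t1} - N \<Longrightarrow> (v has_real_derivative v' r) (at r)"
    and fut: "\<And>r. r \<in> {t0..t1} - N \<Longrightarrow> \<epsilon> * u' r \<ge> 0" "\<And>r. r \<in> {t0..t1} - N \<Longrightarrow> \<epsilon> * v' r \<ge> 0"
    using future_curve_null_coords[OF fc] unfolding u_def v_def u'_def v'_def by blast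
  have uv: "u t0 = 0" "v t0 = 0" "u t1 = P" "v t1 = Q"
    using ends by (simp_all add: u_def v_def P_def Q_def)
  have "lorentz_length A t0 t1 c =
      (\<integral>\<^sup>+ r \<in> {t0..t1}. ennreal (1 / Delta A * (2 * sqrt (u' r * v' r) / (1 + u r + v r))) \<partial>lebesgue)"
    unfolding lorentz_length_def u_def v_def u'_def v'_def
    by (intro nn_integral_cong) (auto simp: indicator_def length_density[OF in_Aff] snd_eq_null[symmetric])
  also have "\<dots> \<le> ennreal (1 / Delta A *
      (\<epsilon> * ln ((\<theta> + u t1) * (1 - \<theta> + v t1) / (\<theta> * (1 - \<theta>) * (1 + u t1 + v t1)))))"
    using Delta_pos \<open>t0 \<le> t1\<close> \<theta> pos uv
    by (intro calibrated_integral_bound[OF eps_square \<theta> _ _ lip N deriv fut]) auto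
  finally show ?thesis
    by (simp add: uv)
qed

text \<open>
  Attains the calibration bound: the curve on which both factors of the calibrating function follow
  \<open>calibrated_geodesic\<close>.
\<close>

lemma geodesic:
  assumes \<theta>: "0 < \<theta>" "\<theta> < 1" and "T \<ge> 0"
    and pos: "1 / \<theta> - \<epsilon> * T > 0" "1 / (1 - \<theta>) - \<epsilon> * T > 0"
  defines "m \<equiv> \<lambda>r. 1 / (1 / \<theta> - \<epsilon> * r)" and "n \<equiv> \<lambda>r. 1 / (1 / (1 - \<theta>) - \<epsilon> * r)"
  defines "c \<equiv> \<lambda>r. aff_id + null_vec (m r - \<theta>) (n r - (1 - \<theta>))"
    and "\<rho> \<equiv> 1 / Delta A * (\<epsilon> * ln (m T * n T / (\<theta> * (1 - \<theta>) * (m T + n T))))"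
  shows "future_curve A 0 T c" "c 0 = aff_id" "lorentz_length A 0 T c = ennreal \<rho>" "\<rho> \<ge> 0"
proof -
  note g' = calibrated_geodesic[OF eps_square \<theta> \<open>T \<ge> 0\<close> pos]
  have g: "m r > 0" "n r > 0" "(m has_real_derivative \<epsilon> * (m r)\<^sup>2) (at r)"
    "(n has_real_derivative \<epsilon> * (n r)\<^sup>2) (at r)" if "r \<in> {0..T}" for r
    unfolding m_def n_def by (intro g'(1-4)[OF that])+
  have g5: "((\<lambda>r. 2 * (m r * n r) / (m r + n r)) has_integral
      \<epsilon> * ln (m T * n T / (\<theta> * (1 - \<theta>) * (m T + n T)))) {0..T}"
    unfolding m_def n_def by (rule g'(5))
  define c' where "c' r = null_vec (\<epsilon> * (m r)\<^sup>2) (\<epsilon> * (n r)\<^sup>2)" for r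
  have c': "(c has_vector_derivative c' r) (at r)" if "r \<in> {0..T}" for r
  proof -
    have "(m has_vector_derivative \<epsilon> * (m r)\<^sup>2) (at r)" "(n has_vector_derivative \<epsilon> * (n r)\<^sup>2) (at r)"
      using g(3,4)[OF that] by (simp_all add: has_real_derivative_iff_has_vector_derivative)
    then show ?thesis
      unfolding c_def c'_def null_vec_def
      by (auto intro!: derivative_eq_intros simp: algebra_simps)
  qed
  have "continuous_on {0..T} m" "continuous_on {0..T} n"
    using g(3,4) by (meson DERIV_isCont continuous_at_imp_continuous_on)+
  then have "continuous_on {0..T} c'"
    unfolding c'_def null_vec_def by (intro continuous_intros)
  then have lip: "\<exists>L. L-lipschitz_on {0..T} c"
    using c' by (intro has_vector_derivative_continuous_imp_lipschitz) auto
  have snd_c: "snd (c r) = m r + n r" for r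
    by (simp add: c_def aff_id_def null_vec_def)
  then have in_Aff: "c r \<in> Aff" if "r \<in> {0..T}" for r
    using g(1,2)[OF that] by (auto simp: Aff_def case_prod_unfold)
  have vd: "vector_derivative c (at r) = c' r" if "r \<in> {0..T}" for r
    using c'[OF that] by (rule vector_derivative_at)
  have fut: "future_nonspacelike A (frame_coords (c r) (c' r))" if "r \<in> {0..T}" for r
    using future_nonspacelike_iff[OF in_Aff[OF that], of "c' r"] eps_square
    by (simp add: c'_def mult.assoc[symmetric])
  have diff: "c differentiable at r" if "r \<in> {0..T}" for r
    using c'[OF that] by (rule differentiableI_vector)
  show "future_curve A 0 T c"
    unfolding future_curve_def using \<open>T \<ge> 0\<close> lip in_Aff fut vd diff
    by (auto intro!: AE_I2)
  show "c 0 = aff_id"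
    using \<theta> by (simp add: c_def m_def n_def null_vec_def zero_prod_def[symmetric])
  have int: "((\<lambda>r. 1 / Delta A * (2 * (m r * n r) / (m r + n r))) has_integral \<rho>) {0..T}"
    unfolding \<rho>_def by (rule has_integral_mult_right[OF g5])
  have nonneg: "0 \<le> 1 / Delta A * (2 * (m r * n r) / (m r + n r))" if "r \<in> {0..T}" for r
    using g(1,2)[OF that] Delta_pos by auto
  show "\<rho> \<ge> 0"
    using int nonneg by (rule has_integral_nonneg)
  have density: "(let v = A *v frame_coords (c r) (vector_derivative c (at r))
      in sqrt ((v $ 1)\<^sup>2 - (v $ 2)\<^sup>2)) = 1 / Delta A * (2 * (m r * n r) / (m r + n r))"
    if "r \<in> {0..T}" for r
  proof -
    have "(\<epsilon> * (m r)\<^sup>2) * (\<epsilon> * (n r)\<^sup>2) = (\<epsilon> * \<epsilon>) * (m r * n r)\<^sup>2"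
      by (simp add: power2_eq_square algebra_simps)
    then have "sqrt ((\<epsilon> * (m r)\<^sup>2) * (\<epsilon> * (n r)\<^sup>2)) = m r * n r"
      using g(1,2)[OF that] by (simp add: eps_square)
    then show ?thesis
      unfolding length_density[OF in_Aff[OF that]] vd[OF that] snd_c by (simp add: c'_def)
  qed
  have "lorentz_length A 0 T c = (\<integral>\<^sup>+ r. ennreal (1 / Delta A * (2 * (m r * n r) / (m r + n r)))
      * indicator {0..T} r \<partial>lebesgue)"
    unfolding lorentz_length_def
    by (intro nn_integral_cong) (auto simp: density indicator_def)
  also have "\<dots> = ennreal \<rho>"
    using nn_integral_has_integral_lebesgue'[OF nonneg int] by (simp add: nn_integral_completion)
  finally show "lorentz_length A 0 T c = ennreal \<rho>" .
qed

end

section \<open>Hyperbolas and their branches\<close>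

text \<open>
  Both equations amount to \<open>2 P Q = Y (C - 1)\<close> where \<open>Y = 1 + P + Q\<close>; in particular \<open>P\<close> and \<open>Q\<close> have the
  same sign. If both are negative then \<open>Y < 1 < C\<close>. If both are positive then \<open>Y \<le> C\<close> would give
  \<open>2 P Q \<ge> Y (P + Q) > 2 P Q\<close>.
\<close>

lemma hyperbola_branch_iff:
  fixes P Q C e :: real
  assumes e: "e = 1 \<or> e = - 1" and C: "C > 1" and Y: "1 + P + Q > 0"
  shows "e * P > 0 \<and> e * Q > 0 \<and> 1 + 2 * P * Q / (1 + P + Q) = C \<longleftrightarrow>
    (1 + P + Q - C)\<^sup>2 - (P - Q)\<^sup>2 = C\<^sup>2 - 1 \<and> sgn (1 + P + Q - C) = e"
proof -
  define Y where "Y = 1 + P + Q"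
  have "Y > 0"
    using Y by (simp add: Y_def)
  have "(Y - C)\<^sup>2 - (P - Q)\<^sup>2 = C\<^sup>2 - 1 \<longleftrightarrow> 2 * P * Q = Y * (C - 1)"
    unfolding Y_def by (auto simp: power2_eq_square algebra_simps)
  moreover have "1 + 2 * P * Q / Y = C \<longleftrightarrow> 2 * P * Q = Y * (C - 1)"
    using \<open>Y > 0\<close> by (auto simp: field_simps)
  moreover have "e * P > 0 \<and> e * Q > 0 \<longleftrightarrow> sgn (Y - C) = e" if PQ: "2 * P * Q = Y * (C - 1)"
  proof -
    have "2 * (P * Q) > 0"
      using PQ \<open>Y > 0\<close> C by (simp add: mult.assoc)
    then have signs: "P > 0 \<and> Q > 0 \<or> P < 0 \<and> Q < 0"
      by (auto simp: zero_less_mult_iff)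
    have above: "Y > C" if "P > 0" "Q > 0"
    proof (rule ccontr)
      assume "\<not> Y > C"
      then have "Y * (P + Q) \<le> Y * (C - 1)"
        using \<open>Y > 0\<close> by (intro mult_left_mono) (auto simp: Y_def)
      moreover have "Y * (P + Q) > 2 * P * Q"
        using that by (auto simp: Y_def algebra_simps intro!: add_pos_pos)
      ultimately show False
        using PQ by simp
    qed
    show ?thesis
      using signs above C e by (auto simp: sgn_real_def Y_def split: if_splits)
  qed
  ultimately show ?thesis
    unfolding Y_def[symmetric] by blast
qed

lemma is_hyperbola_affine:
  fixes k l C S :: real
  assumes "l \<noteq> 0" "S \<noteq> 0"
  shows "is_hyperbola {(x, y). (y - C)\<^sup>2 - ((x + k * (y - 1)) / l)\<^sup>2 = S\<^sup>2}"
proof -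
  \<comment> \<open>In these terms \<open>w\<close> is the affine form \<open>h x + n y - n\<close>, from which the coefficients of the conic are read off.\<close>
  define h n where "h = 1 / l" and "n = k / l"
  have w: "(x + k * (y - 1)) / l = h * x + n * y - n" for x y
    using assms by (simp add: h_def n_def field_simps)
  have "h \<noteq> 0"
    using assms by (simp add: h_def)
  have "{(x, y). (y - C)\<^sup>2 - ((x + k * (y - 1)) / l)\<^sup>2 = S\<^sup>2} =
    {(x, y). - (h\<^sup>2) * x\<^sup>2 + 2 * (- h * n) * x * y + (1 - n\<^sup>2) * y\<^sup>2
      + 2 * (h * n) * x + 2 * (n\<^sup>2 - C) * y + (C\<^sup>2 - n\<^sup>2 - S\<^sup>2) = 0}"
    unfolding w by (auto simp: power2_eq_square algebra_simps)
  moreover have "(- h * n)\<^sup>2 - (- (h\<^sup>2)) * (1 - n\<^sup>2) = h\<^sup>2"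
    by (simp add: power2_eq_square algebra_simps)
  moreover have "det (vector [vector [- (h\<^sup>2), - h * n, h * n], vector [- h * n, 1 - n\<^sup>2, n\<^sup>2 - C],
      vector [h * n, n\<^sup>2 - C, C\<^sup>2 - n\<^sup>2 - S\<^sup>2]] :: real^3^3) = h\<^sup>2 * S\<^sup>2"
    by (simp add: det_3 vector_3 power2_eq_square algebra_simps)
  moreover have "h\<^sup>2 > 0" "h\<^sup>2 * S\<^sup>2 \<noteq> 0"
    using \<open>h \<noteq> 0\<close> assms(2) by auto
  ultimately show ?thesis
    unfolding is_hyperbola_def
    by (intro exI[of _ "- (h\<^sup>2)"] exI[of _ "- h * n"] exI[of _ "1 - n\<^sup>2"] exI[of _ "h * n"]
        exI[of _ "n\<^sup>2 - C"] exI[of _ "C\<^sup>2 - n\<^sup>2 - S\<^sup>2"]) argo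
qed

text \<open>
  Used to show that a curve leaves every compact subset of the group as soon as its second coordinate
  tends to \<open>0\<close> or to infinity.
\<close>

lemma compact_subset_Aff_bounds:
  assumes "compact K" "K \<subseteq> Aff"
  obtains lo hi where "0 < lo" "\<And>q. q \<in> K \<Longrightarrow> lo \<le> snd q \<and> snd q \<le> hi"
proof (cases "K = {}")
  case False
  have cont: "continuous_on K (snd :: real \<times> real \<Rightarrow> real)"
    by (intro continuous_intros)
  obtain q0 where "q0 \<in> K" "\<And>q. q \<in> K \<Longrightarrow> snd q0 \<le> snd q"
    using continuous_attains_inf[OF assms(1) False cont] by blast
  moreover obtain q1 :: "real \<times> real" where "\<And>q. q \<in> K \<Longrightarrow> snd q \<le> snd q1"
    using continuous_attains_sup[OF assms(1) False cont] by blast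
  ultimately show ?thesis
    using assms(2) that[of "snd q0" "snd q1"] by (auto simp: Aff_def)
qed (use that[of 1] in auto)

text \<open>
  In the coordinates \<open>w = (x + k (y - 1)) / l\<close> and \<open>y\<close> the set is the graph of \<open>f\<close> over the part of the
  line where \<open>f\<close> is positive.
\<close>

lemma arc_noncompact_graph:
  fixes k l :: real and f g h :: "real \<Rightarrow> real"
  assumes l: "l \<noteq> 0" and f: "continuous_on UNIV f"
    and gh: "homeomorphism UNIV {w. f w > 0} g h"
    and ends: "\<And>F. F = at_top \<or> F = at_bot \<Longrightarrow>
      filterlim (\<lambda>t. f (g t)) at_top F \<or> ((\<lambda>t. f (g t)) \<longlongrightarrow> 0) F"
  shows "arc_noncompact_both_ways Aff
    {(x, y) \<in> Aff. y = f ((x + k * (y - 1)) / l)}" (is "arc_noncompact_both_ways _ ?S")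
proof -
  define p where "p w = (l * w - k * (f w - 1), f w)" for w
  define q where "q z = (fst z + k * (snd z - 1)) / l" for z
  have "homeomorphism {w. f w > 0} ?S p q"
  proof (rule homeomorphismI)
    show "continuous_on {w. 0 < f w} p"
      unfolding p_def by (intro continuous_intros continuous_on_subset[OF f]) auto
    show "continuous_on ?S q"
      unfolding q_def using l by (intro continuous_intros) auto
  qed (use l in \<open>auto simp: p_def q_def Aff_def field_simps\<close>)
  from homeomorphism_compose[OF gh this]
  have homeo: "homeomorphism UNIV ?S (p \<circ> g) (h \<circ> q)" .
  have leaves: "\<forall>\<^sub>F t in F. (p \<circ> g) t \<notin> K"
    if K: "compact K" "K \<subseteq> Aff" and F: "F = at_top \<or> F = at_bot" for K and F :: "real filter"
  proof -
    obtain lo hi where b: "0 < lo" "\<And>z. z \<in> K \<Longrightarrow> lo \<le> snd z \<and> snd z \<le> hi"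
      using compact_subset_Aff_bounds[OF K] by blast
    from ends[OF F] have "\<forall>\<^sub>F t in F. f (g t) < lo \<or> f (g t) > hi"
    proof
      assume "filterlim (\<lambda>t. f (g t)) at_top F"
      then have "\<forall>\<^sub>F t in F. hi < f (g t)"
        by (simp add: filterlim_at_top_dense)
      then show ?thesis
        by eventually_elim simp
    next
      assume "((\<lambda>t. f (g t)) \<longlongrightarrow> 0) F"
      from order_tendstoD(2)[OF this b(1)] show ?thesis
        by eventually_elim simp
    qed
    then show ?thesis
      by eventually_elim (use b in \<open>force simp: p_def\<close>)
  qed
  show ?thesis
    unfolding arc_noncompact_both_ways_def using homeo leaves by blast
qed

text \<open>
  If \<open>e = 1\<close> then \<open>y\<close> is positive for all \<open>w\<close>. If \<open>e = -1\<close> then \<open>y > 0\<close> means \<open>w\<^sup>2 < C\<^sup>2 - S\<^sup>2 = 1\<close>, and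
  \<open>w = t / sqrt (1 + t\<^sup>2)\<close> parametrizes that interval by the line.
\<close>

lemma arc_noncompact_hyperbola_branch:
  fixes k l C S e :: real
  assumes l: "l \<noteq> 0" and e: "e = 1 \<or> e = - 1" and C: "C > 1" "C\<^sup>2 = 1 + S\<^sup>2"
  shows "arc_noncompact_both_ways Aff
    {(x, y) \<in> Aff. y = C + e * sqrt (((x + k * (y - 1)) / l)\<^sup>2 + S\<^sup>2)}"
proof -
  define f where "f w = C + e * sqrt (w\<^sup>2 + S\<^sup>2)" for w
  have cont: "continuous_on UNIV f"
    unfolding f_def by (intro continuous_intros)
  have sqrtC: "sqrt (1 + S\<^sup>2) = C"
    using C by (metis abs_of_pos less_trans real_sqrt_abs zero_less_one)
  from e have "\<exists>g h :: real \<Rightarrow> real. homeomorphism UNIV {w. f w > 0} g h \<and>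
    (\<forall>F. F = at_top \<or> F = at_bot \<longrightarrow>
      filterlim (\<lambda>t. f (g t)) at_top F \<or> ((\<lambda>t. f (g t)) \<longlongrightarrow> 0) F)"
  proof
    assume "e = 1"
    have "f w > 0" for w
      unfolding f_def \<open>e = 1\<close> using C by (simp add: add_pos_nonneg)
    then have "homeomorphism UNIV {w. f w > 0} id id"
      by (auto simp: homeomorphism_def)
    moreover have "filterlim f at_top F" if F: "F = at_top \<or> F = at_bot" for F
    proof (rule filterlim_at_top_mono)
      show "filterlim (\<lambda>w::real. \<bar>w\<bar>) at_top F"
        using F filterlim_abs_real
          filterlim_compose[OF filterlim_abs_real filterlim_uminus_at_top_at_bot]
        by auto
      have "\<bar>w\<bar> \<le> f w" for w
        unfolding f_def \<open>e = 1\<close> using C real_sqrt_ge_abs1[of w S] by linarith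
      then show "\<forall>\<^sub>F w in F. \<bar>w\<bar> \<le> f w"
        by simp
    qed
    ultimately show ?thesis
      by (intro exI[of _ id] conjI) auto
  next
    assume "e = - 1"
    define g where "g t = t / sqrt (1 + t\<^sup>2)" for t :: real
    define h where "h w = w / sqrt (1 - w\<^sup>2)" for w :: real
    have f_pos: "f w > 0 \<longleftrightarrow> w\<^sup>2 < 1" for w
    proof -
      have "f w > 0 \<longleftrightarrow> sqrt (w\<^sup>2 + S\<^sup>2) < sqrt (1 + S\<^sup>2)"
        unfolding sqrtC by (simp add: f_def \<open>e = - 1\<close>)
      then show ?thesis by simp
    qed
    have pos: "1 + t\<^sup>2 > 0" for t :: real
      by (intro add_pos_nonneg) auto
    have sqrt_pos: "sqrt (1 + t\<^sup>2) > 0" for t :: real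
      using pos by (rule real_sqrt_gt_zero)
    have g_sq: "(g t)\<^sup>2 = t\<^sup>2 / (1 + t\<^sup>2)" for t
      using pos[of t] by (simp add: g_def power_divide)
    have "homeomorphism UNIV {w. w\<^sup>2 < 1} g h"
    proof (rule homeomorphismI)
      show "continuous_on UNIV g"
        unfolding g_def using sqrt_pos by (intro continuous_intros) (auto simp: less_imp_neq[symmetric])
      show "continuous_on {w. w\<^sup>2 < 1} h"
        unfolding h_def by (intro continuous_intros) auto
      show "g ` UNIV \<subseteq> {w. w\<^sup>2 < 1}"
        using pos by (auto simp: g_sq)
      show "h (g t) = t" for t
      proof -
        have "1 - (g t)\<^sup>2 = 1 / (1 + t\<^sup>2)"
          using pos[of t] by (simp add: g_sq field_simps)
        then show ?thesis
          using sqrt_pos[of t] by (simp add: h_def real_sqrt_divide) (simp add: g_def)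
      qed
      show "g (h w) = w" if "w \<in> {w. w\<^sup>2 < 1}" for w
      proof -
        have w: "1 - w\<^sup>2 > 0"
          using that by simp
        then have "1 + (h w)\<^sup>2 = 1 / (1 - w\<^sup>2)"
          by (simp add: h_def power_divide field_simps)
        then show ?thesis
          using w by (simp add: g_def real_sqrt_divide) (simp add: h_def)
      qed
    qed auto
    moreover have "((\<lambda>t. f (g t)) \<longlongrightarrow> 0) F" if F: "F = at_top \<or> F = at_bot" for F
    proof -
      have "filterlim (\<lambda>t::real. t\<^sup>2) at_top F"
        using F by (auto simp: filterlim_pow_at_top filterlim_pow_at_bot_even filterlim_ident)
      then have "((\<lambda>t::real. 1 - inverse (1 + t\<^sup>2)) \<longlongrightarrow> 1 - 0) F"
        by (intro tendsto_intros tendsto_inverse_0_at_top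
            filterlim_tendsto_add_at_top[OF tendsto_const])
      also have "(\<lambda>t::real. 1 - inverse (1 + t\<^sup>2)) = (\<lambda>t. (g t)\<^sup>2)"
      proof
        show "1 - inverse (1 + t\<^sup>2) = (g t)\<^sup>2" for t :: real
          using pos[of t] by (simp add: g_sq field_simps)
      qed
      finally have "((\<lambda>t. C + e * sqrt ((g t)\<^sup>2 + S\<^sup>2)) \<longlongrightarrow> C + e * sqrt (1 + S\<^sup>2)) F"
        by (intro tendsto_intros) simp
      then show ?thesis
        by (simp add: f_def sqrtC \<open>e = - 1\<close>)
    qed
    ultimately show ?thesis
      unfolding f_pos by blast
  qed
  then show ?thesis
    using arc_noncompact_graph[OF l cont] unfolding f_def by blast
qed

section \<open>The distance formula and the spheres\<close>

context positive_curvature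
begin

lemma lorentz_dist_unreachable:
  assumes "\<not> (\<epsilon> * null1 (q - aff_id) \<ge> 0 \<and> \<epsilon> * null2 (q - aff_id) \<ge> 0)"
  shows "lorentz_dist A aff_id q = 0"
proof -
  have "{lorentz_length A s t c | s t c. future_curve A s t c \<and> c s = aff_id \<and> c t = q} = {}"
    using assms future_curve_endpoint by blast
  then show ?thesis
    unfolding lorentz_dist_def by (simp only: Sup_empty bot_ennreal)
qed

lemma lorentz_dist_le:
  fixes q :: "real \<times> real"
  assumes "0 < \<theta>" "\<theta> < 1"
  defines "P \<equiv> null1 (q - aff_id)" and "Q \<equiv> null2 (q - aff_id)"
  assumes "\<theta> + P > 0" "1 - \<theta> + Q > 0"
  shows "lorentz_dist A aff_id q \<le> ennreal (1 / Delta A *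
    (\<epsilon> * ln ((\<theta> + P) * (1 - \<theta> + Q) / (\<theta> * (1 - \<theta>) * (1 + P + Q)))))"
  unfolding lorentz_dist_def P_def Q_def
  using lorentz_length_le[of _ _ _ q \<theta>] assms by (intro Sup_least) blast

text \<open>
  The two coordinates play symmetric roles under \<open>\<theta> \<mapsto> 1 - \<theta>\<close>. In either case the calibration bound,
  with \<open>t\<close> the distance of \<open>\<theta>\<close> from \<open>0\<close> or \<open>1\<close> and \<open>z\<close> the other coordinate, tends to \<open>0\<close> with \<open>t\<close>.
\<close>

lemma lorentz_dist_null:
  assumes "q \<in> Aff" and null: "null1 (q - aff_id) = 0 \<or> null2 (q - aff_id) = 0"
  shows "lorentz_dist A aff_id q = 0"
proof -
  have y: "1 + null1 (q - aff_id) + null2 (q - aff_id) > 0"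
    using assms(1) snd_eq_null[of q] by (auto simp: Aff_def)
  have lim: "((\<lambda>t. ennreal (1 / Delta A * (\<epsilon> * ln ((1 - t + z) / ((1 - t) * (1 + z)))))) \<longlongrightarrow> 0)
      (at_right 0)" if "1 + z > 0" for z
  proof -
    have "((\<lambda>t. ennreal (1 / Delta A * (\<epsilon> * ln ((1 - t + z) / ((1 - t) * (1 + z)))))) \<longlongrightarrow>
        ennreal (1 / Delta A * (\<epsilon> * ln ((1 - 0 + z) / ((1 - 0) * (1 + z)))))) (at_right 0)"
      using that Delta_pos by (intro tendsto_intros) auto
    then show ?thesis
      using that by simp
  qed
  have "lorentz_dist A aff_id q \<le> 0"
    using null
  proof
    assume P: "null1 (q - aff_id) = 0"
    define z where "z = null2 (q - aff_id)"
    have z: "1 + z > 0"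
      using y by (simp add: P z_def)
    have "\<forall>\<^sub>F t in at_right 0. t \<in> {0<..<min 1 (1 + z)}"
      using z by (intro eventually_at_right_real) simp
    then have "\<forall>\<^sub>F t in at_right 0. lorentz_dist A aff_id q \<le>
        ennreal (1 / Delta A * (\<epsilon> * ln ((1 - t + z) / ((1 - t) * (1 + z)))))"
    proof eventually_elim
      case (elim t)
      then show ?case
        using lorentz_dist_le[of t q] unfolding P z_def[symmetric] by auto
    qed
    from tendsto_lowerbound[OF lim[OF z] this] show ?thesis
      by simp
  next
    assume Q: "null2 (q - aff_id) = 0"
    define z where "z = null1 (q - aff_id)"
    have z: "1 + z > 0"
      using y by (simp add: Q z_def)
    have "\<forall>\<^sub>F t in at_right 0. t \<in> {0<..<min 1 (1 + z)}"
      using z by (intro eventually_at_right_real) simp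
    then have "\<forall>\<^sub>F t in at_right 0. lorentz_dist A aff_id q \<le>
        ennreal (1 / Delta A * (\<epsilon> * ln ((1 - t + z) / ((1 - t) * (1 + z)))))"
    proof eventually_elim
      case (elim t)
      then show ?case
        using lorentz_dist_le[of "1 - t" q] unfolding Q z_def[symmetric] by (auto simp: mult.commute)
    qed
    from tendsto_lowerbound[OF lim[OF z] this] show ?thesis
      by simp
  qed
  then show ?thesis
    by simp
qed

text \<open>
  The calibration bound for the optimal \<open>\<theta>\<close> is attained by the geodesic of \<open>geodesic\<close> run up to the
  parameter \<open>T\<close> at which it reaches \<open>q\<close>.
\<close>

lemma lorentz_dist_timelike:
  fixes q :: "real \<times> real"
  assumes "q \<in> Aff"
  defines "P \<equiv> null1 (q - aff_id)" and "Q \<equiv> null2 (q - aff_id)"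
  assumes P: "\<epsilon> * P > 0" and Q: "\<epsilon> * Q > 0"
  shows "lorentz_dist A aff_id q = ennreal (arcosh (1 + 2 * P * Q / snd q) / Delta A)"
proof -
  have y: "snd q = 1 + P + Q" "1 + P + Q > 0"
    using assms(1) snd_eq_null[of q] by (auto simp: Aff_def P_def Q_def)
  obtain \<theta> where \<theta>: "0 < \<theta>" "\<theta> < 1" and pos: "\<theta> + P > 0" "1 - \<theta> + Q > 0"
    and opt: "P * (1 - \<theta>) * (1 - \<theta> + Q) = Q * \<theta> * (\<theta> + P)"
    using optimal_calibration[OF eps_cases P Q y(2)] .
  define E where "E = (\<theta> + P) * (1 - \<theta> + Q) / (\<theta> * (1 - \<theta>) * (1 + P + Q))"
  define \<rho> where "\<rho> = 1 / Delta A * (\<epsilon> * ln E)"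
  have upper: "lorentz_dist A aff_id q \<le> ennreal \<rho>"
    using lorentz_dist_le[OF \<theta>, of q] pos by (simp add: \<rho>_def E_def P_def Q_def)
  have frac: "1 / t - z / (t * (t + z)) = 1 / (t + z)" if "t > 0" "t + z > 0" for t z :: real
    using that by (simp add: divide_simps)
  define T where "T = \<epsilon> * P / (\<theta> * (\<theta> + P))"
  have "T \<ge> 0"
    using P \<theta> pos by (simp add: T_def)
  have "\<epsilon> * T = P / (\<theta> * (\<theta> + P))"
    by (simp add: T_def mult.assoc[symmetric] eps_square)
  then have m: "1 / \<theta> - \<epsilon> * T = 1 / (\<theta> + P)"
    using frac[of \<theta> P] \<theta> pos by simp
  have "P / (\<theta> * (\<theta> + P)) = Q / ((1 - \<theta>) * (1 - \<theta> + Q))"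
    using \<theta> pos opt by (simp add: frac_eq_eq ac_simps)
  with \<open>\<epsilon> * T = _\<close> have "\<epsilon> * T = Q / ((1 - \<theta>) * (1 - \<theta> + Q))"
    by simp
  then have n: "1 / (1 - \<theta>) - \<epsilon> * T = 1 / (1 - \<theta> + Q)"
    using frac[of "1 - \<theta>" Q] \<theta> pos by simp
  note g = geodesic[OF \<theta> \<open>T \<ge> 0\<close>, unfolded m n]
  define c where "c = (\<lambda>r. aff_id + null_vec (1 / (1 / \<theta> - \<epsilon> * r) - \<theta>)
    (1 / (1 / (1 - \<theta>) - \<epsilon> * r) - (1 - \<theta>)))"
  have c: "future_curve A 0 T c" "c 0 = aff_id" "lorentz_length A 0 T c = ennreal \<rho>" and "\<rho> \<ge> 0"
    using g pos by (simp_all add: c_def \<rho>_def E_def add_ac)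
  have "c T = q"
    using null_vec_null[of "q - aff_id"] by (simp add: c_def m n P_def Q_def)
  with c have "ennreal \<rho> \<in>
      {lorentz_length A s t c | s t c. future_curve A s t c \<and> c s = aff_id \<and> c t = q}"
    by (metis (mono_tags, lifting) mem_Collect_eq)
  then have "ennreal \<rho> \<le> lorentz_dist A aff_id q"
    unfolding lorentz_dist_def by (rule Sup_upper)
  with upper have "lorentz_dist A aff_id q = ennreal \<rho>"
    by simp
  moreover have "\<rho> = arcosh (1 + 2 * P * Q / snd q) / Delta A"
  proof -
    have "\<epsilon> * ln E \<ge> 0"
      using \<open>\<rho> \<ge> 0\<close> Delta_pos by (simp add: \<rho>_def zero_le_divide_iff)
    moreover have "cosh (\<epsilon> * ln E) = 1 + 2 * P * Q / snd q"
      using optimal_calibration_value[OF \<theta> pos opt] eps_cases by (auto simp: E_def y)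
    ultimately show ?thesis
      by (metis \<rho>_def arcosh_cosh_real mult_1 times_divide_eq_left)
  qed
  ultimately show ?thesis
    by simp
qed

lemma lorentz_dist_eq:
  fixes q :: "real \<times> real"
  assumes "q \<in> Aff"
  defines "P \<equiv> null1 (q - aff_id)" and "Q \<equiv> null2 (q - aff_id)"
  shows "lorentz_dist A aff_id q =
    (if \<epsilon> * P > 0 \<and> \<epsilon> * Q > 0 then ennreal (arcosh (1 + 2 * P * Q / snd q) / Delta A) else 0)"
proof (cases "\<epsilon> * P > 0 \<and> \<epsilon> * Q > 0")
  case True
  then show ?thesis
    using lorentz_dist_timelike[OF assms(1)] by (simp add: P_def Q_def)
next
  case False
  then consider "\<not> (\<epsilon> * P \<ge> 0 \<and> \<epsilon> * Q \<ge> 0)" | "P = 0 \<or> Q = 0"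
    using eps_cases by fastforce
  then have "lorentz_dist A aff_id q = 0"
    using lorentz_dist_unreachable[of q] lorentz_dist_null[OF assms(1)]
    by cases (auto simp: P_def Q_def)
  with False show ?thesis
    by auto
qed

lemma null_pos_iff_lambda:
  "\<epsilon> * null1 (q - aff_id) > 0 \<longleftrightarrow> lambda1 A q < 0"
  "\<epsilon> * null2 (q - aff_id) > 0 \<longleftrightarrow> lambda2 A q > 0"
proof -
  define k1 where "k1 = (\<epsilon> * (A $ 2 $ 1 + A $ 1 $ 1)) / (2 * det A)"
  define k2 where "k2 = (\<epsilon> * (A $ 2 $ 1 - A $ 1 $ 1)) / (2 * det A)"
  have "k1 < 0" "k2 < 0"
    using eps_factors det_pos by (auto simp: k1_def k2_def intro!: divide_neg_pos)
  moreover have "\<epsilon> * null1 (q - aff_id) = k1 * lambda1 A q"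
    "\<epsilon> * null2 (q - aff_id) = - k2 * lambda2 A q"
    by (simp_all add: k1_def k2_def null1_def null2_def lambda1_def lambda2_def aff_id_def
        add_divide_distrib diff_divide_distrib algebra_simps)
  ultimately show "\<epsilon> * null1 (q - aff_id) > 0 \<longleftrightarrow> lambda1 A q < 0"
    "\<epsilon> * null2 (q - aff_id) > 0 \<longleftrightarrow> lambda2 A q > 0"
    by (simp_all add: zero_less_mult_iff mult_less_0_iff)
qed

lemma arcosh_timelike_pos:
  assumes "q \<in> Aff" "\<epsilon> * P > 0" "\<epsilon> * Q > 0"
  shows "1 + 2 * P * Q / snd q > 1" "arcosh (1 + 2 * P * Q / snd q) / Delta A > 0"
proof -
  have "snd q > 0"
    using assms(1) by (auto simp: Aff_def)
  moreover have "P * Q > 0"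
    using assms(2,3) eps_cases by (auto simp: zero_less_mult_iff)
  ultimately show gt: "1 + 2 * P * Q / snd q > 1"
    by (simp add: mult.assoc)
  then show "arcosh (1 + 2 * P * Q / snd q) / Delta A > 0"
    using Delta_pos by (auto intro!: divide_pos_pos)
qed

lemma lorentz_sphere_zero:
  "lorentz_sphere A 0 = {q \<in> Aff. lambda1 A q \<ge> 0 \<or> lambda2 A q \<le> 0}"
proof -
  have "lorentz_dist A aff_id q = 0 \<longleftrightarrow> lambda1 A q \<ge> 0 \<or> lambda2 A q \<le> 0" if "q \<in> Aff" for q
    using arcosh_timelike_pos(2)[OF that, of "null1 (q - aff_id)" "null2 (q - aff_id)"]
    unfolding lorentz_dist_eq[OF that] null_pos_iff_lambda
    by (auto simp: ennreal_eq_0_iff)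
  then show ?thesis
    unfolding lorentz_sphere_def by blast
qed

lemma lorentz_sphere_infinity: "lorentz_sphere A \<infinity> = {}"
  by (auto simp: lorentz_sphere_def lorentz_dist_eq)

text \<open>
  The distance equals \<open>R\<close> iff \<open>\<epsilon> P, \<epsilon> Q > 0\<close> and \<open>1 + 2 P Q / y = cosh (\<Delta> R)\<close>, which is turned into
  the equation of the branch by \<open>hyperbola_branch_iff\<close>.
\<close>

lemma lorentz_dist_eq_iff:
  fixes x y R :: real
  assumes R: "R > 0" and xy: "(x, y) \<in> Aff"
  shows "lorentz_dist A aff_id (x, y) = ennreal R \<longleftrightarrow>
    (y - cosh (Delta A * R))\<^sup>2 - ((x + nu A * (y - 1)) / lam A)\<^sup>2 = (sinh (Delta A * R))\<^sup>2 \<and>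
    sgn (y - cosh (Delta A * R)) = \<epsilon>"
proof -
  define P where "P = null1 ((x, y) - aff_id)"
  define Q where "Q = null2 ((x, y) - aff_id)"
  define C where "C = cosh (Delta A * R)"
  have y: "y = 1 + P + Q" "1 + P + Q > 0"
    using xy snd_eq_null[of "(x, y)"] by (auto simp: Aff_def P_def Q_def)
  have w: "(x + nu A * (y - 1)) / lam A = P - Q"
    using null_diff[of "(x, y) - aff_id"] by (simp add: P_def Q_def aff_id_def)
  have S: "(sinh (Delta A * R))\<^sup>2 = C\<^sup>2 - 1"
    using cosh_square_eq[of "Delta A * R"] by (simp add: C_def)
  have "Delta A * R > 0"
    using Delta_pos R by simp
  then have C: "C > 1"
    by (simp add: C_def cosh_real_strict_mono[of 0, simplified])
  have "lorentz_dist A aff_id (x, y) = ennreal R \<longleftrightarrow>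
      \<epsilon> * P > 0 \<and> \<epsilon> * Q > 0 \<and> arcosh (1 + 2 * P * Q / y) = Delta A * R"
    using arcosh_timelike_pos(2)[OF xy, of P Q] R Delta_pos
    unfolding lorentz_dist_eq[OF xy] P_def[symmetric] Q_def[symmetric]
    by (auto simp: ennreal_inj field_simps dest: sym)
  also have "\<dots> \<longleftrightarrow> \<epsilon> * P > 0 \<and> \<epsilon> * Q > 0 \<and> 1 + 2 * P * Q / y = C"
  proof -
    have "arcosh z = Delta A * R \<longleftrightarrow> z = C" if "z > 1" for z
    proof
      assume "arcosh z = Delta A * R"
      then show "z = C"
        using that unfolding C_def by (metis cosh_arcosh_real less_imp_le)
    next
      assume "z = C"
      then show "arcosh z = Delta A * R"
        unfolding C_def using \<open>Delta A * R > 0\<close> arcosh_cosh_real less_imp_le by blast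
    qed
    then show ?thesis
      using arcosh_timelike_pos(1)[OF xy, of P Q] by auto
  qed
  also have "\<dots> \<longleftrightarrow> (y - C)\<^sup>2 - (P - Q)\<^sup>2 = C\<^sup>2 - 1 \<and> sgn (y - C) = \<epsilon>"
    unfolding y(1) by (rule hyperbola_branch_iff[OF eps_cases C y(2)])
  finally show ?thesis
    unfolding w S C_def .
qed

lemma lorentz_sphere_pos:
  assumes "R > 0"
  defines "C \<equiv> cosh (Delta A * R)" and "S \<equiv> sinh (Delta A * R)"
  shows "lorentz_sphere A (ennreal R) =
      {(x, y) \<in> Aff. (y - C)\<^sup>2 - ((x + nu A * (y - 1)) / lam A)\<^sup>2 = S\<^sup>2 \<and> sgn (y - C) = \<epsilon>}"
    and "is_hyperbola {(x, y). (y - C)\<^sup>2 - ((x + nu A * (y - 1)) / lam A)\<^sup>2 = S\<^sup>2}"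
    and "arc_noncompact_both_ways Aff (lorentz_sphere A (ennreal R))"
proof -
  have "Delta A * R > 0"
    using Delta_pos assms(1) by simp
  then have S: "S > 0" and C: "C > 1"
    by (simp_all add: S_def C_def cosh_real_strict_mono[of 0, simplified])
  show sphere: "lorentz_sphere A (ennreal R) =
      {(x, y) \<in> Aff. (y - C)\<^sup>2 - ((x + nu A * (y - 1)) / lam A)\<^sup>2 = S\<^sup>2 \<and> sgn (y - C) = \<epsilon>}"
    unfolding lorentz_sphere_def using lorentz_dist_eq_iff[OF assms(1)]
    by (auto simp: C_def S_def)
  show "is_hyperbola {(x, y). (y - C)\<^sup>2 - ((x + nu A * (y - 1)) / lam A)\<^sup>2 = S\<^sup>2}"
    using lam_pos S by (intro is_hyperbola_affine) auto
  have branch: "(y - C)\<^sup>2 - w\<^sup>2 = S\<^sup>2 \<and> sgn (y - C) = \<epsilon> \<longleftrightarrow> y = C + \<epsilon> * sqrt (w\<^sup>2 + S\<^sup>2)" for w y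
  proof
    assume *: "(y - C)\<^sup>2 - w\<^sup>2 = S\<^sup>2 \<and> sgn (y - C) = \<epsilon>"
    then have "\<bar>y - C\<bar> = sqrt (w\<^sup>2 + S\<^sup>2)"
      by (metis add.commute diff_add_cancel real_sqrt_abs)
    with * show "y = C + \<epsilon> * sqrt (w\<^sup>2 + S\<^sup>2)"
      using sgn_mult_abs[of "y - C"] by simp
  next
    assume *: "y = C + \<epsilon> * sqrt (w\<^sup>2 + S\<^sup>2)"
    have "w\<^sup>2 + S\<^sup>2 > 0"
      using S by (simp add: add_nonneg_pos)
    then show "(y - C)\<^sup>2 - w\<^sup>2 = S\<^sup>2 \<and> sgn (y - C) = \<epsilon>"
      using eps_cases by (auto simp: * sgn_mult)
  qed
  have "C\<^sup>2 = 1 + S\<^sup>2"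
    by (simp add: C_def S_def cosh_square_eq)
  then show "arc_noncompact_both_ways Aff (lorentz_sphere A (ennreal R))"
    unfolding sphere branch using lam_pos C eps_cases
    by (intro arc_noncompact_hyperbola_branch) auto
qed

end

theorem corollary5:
  fixes A :: "real^2^2"
  assumes "det A > 0" and "A $ 1 $ 1 \<ge> 0" and "sectional_curvature A > 0"
  shows "lorentz_sphere A 0 = {q \<in> Aff. lambda1 A q \<ge> 0 \<or> lambda2 A q \<le> 0} \<and>
    (\<forall>R::real. R > 0 \<longrightarrow>
      (let s1 = sgn (matrix_inv A $ 2 $ 1);
           \<sigma> = s1 * Delta A * R;
           w = (\<lambda>x y. (x + nu A * (y - 1)) / lam A);
           H = {(x, y). (y - cosh \<sigma>)\<^sup>2 - (w x y)\<^sup>2 = (sinh \<sigma>)\<^sup>2}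
       in lorentz_sphere A (ennreal R) = {(x, y) \<in> Aff \<inter> H. sgn (y - cosh \<sigma>) = s1} \<and>
          is_hyperbola H \<and>
          arc_noncompact_both_ways Aff (lorentz_sphere A (ennreal R)))) \<and>
    lorentz_sphere A \<infinity> = {}"
proof -
  have "(A $ 1 $ 1)\<^sup>2 < (A $ 2 $ 1)\<^sup>2"
    using assms(1,3) by (simp add: sectional_curvature_eq(1) zero_less_divide_iff)
  then have "\<bar>A $ 1 $ 1\<bar> < \<bar>A $ 2 $ 1\<bar>"
    by (simp flip: abs_le_square_iff not_le)
  then interpret positive_curvature A
    using assms(1) by unfold_locales
  \<comment> \<open>The sign in \<open>\<sigma>\<close> affects neither \<open>cosh\<close> nor the square of \<open>sinh\<close>.\<close>
  have \<sigma>: "cosh (\<epsilon> * Delta A * R) = cosh (Delta A * R)"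
    "(sinh (\<epsilon> * Delta A * R))\<^sup>2 = (sinh (Delta A * R))\<^sup>2" for R
    using eps_cases by auto
  have "lorentz_sphere A (ennreal R) =
      {(x, y) \<in> Aff \<inter> {(x, y). (y - cosh (\<epsilon> * Delta A * R))\<^sup>2 - ((x + nu A * (y - 1)) / lam A)\<^sup>2 =
        (sinh (\<epsilon> * Delta A * R))\<^sup>2}. sgn (y - cosh (\<epsilon> * Delta A * R)) = \<epsilon>}"
    and "is_hyperbola {(x, y). (y - cosh (\<epsilon> * Delta A * R))\<^sup>2 -
        ((x + nu A * (y - 1)) / lam A)\<^sup>2 = (sinh (\<epsilon> * Delta A * R))\<^sup>2}"
    if "R > 0" for R
    unfolding \<sigma> using lorentz_sphere_pos(1,2)[OF that] by auto
  then show ?thesis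
    unfolding Let_def \<epsilon>_def[symmetric]
    using lorentz_sphere_zero lorentz_sphere_infinity lorentz_sphere_pos(3) by blast
qed

end
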